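(* Let $M$ be a Riemannian manifold endowed with the corresponding volume form $V$ and let $f: M\to M$ be a diffeomorphism. Assume that there exists $a\in(0,1)$ such that the function $A: M\to\mathbb R$ defined by $f^*V=A\,V$ satisfies $|A|\le a$ everywhere on $M$. Let $B(f)$ be the set of points $x\in M$ such that the sequence $(f^{-n}(x))_{n\in\mathbb N}$ does not tend to infinity as $n\to+\infty$. Then $V(B(f))=0$.
   Context: A sequence $(x_n)_{n\in\mathbb N}$ of points of a topological space $X$ tends to infinity if for every compact subset $K$ of $X$ there exists $N\in\mathbb N$ such that $x_n\notin K$ for all $n\ge N$. For a measurable set $E\subset M$, $V(E)$ denotes its measure for the Riemannian volume. *)

theory Defs
  imports "HOL-Analysis.Analysis"
begin

section \<open>Smooth maps between open subsets of Euclidean spaces\<close>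

text \<open>Only meaningful for open \<open>S\<close>, where \<open>differentiable_on\<close> and differentiability at every
  point agree. In finite dimension, being of class \<open>C\<^sup>k\<^sup>+\<^sup>1\<close> amounts to being differentiable with all
  directional derivatives of class \<open>C\<^sup>k\<close>.\<close>

primrec Ck_on :: "nat \<Rightarrow> 'b::real_normed_vector set \<Rightarrow> ('b \<Rightarrow> 'c::real_normed_vector) \<Rightarrow> bool" where
  "Ck_on 0 S f \<longleftrightarrow> continuous_on S f"
| "Ck_on (Suc k) S f \<longleftrightarrow>
     f differentiable_on S \<and> (\<forall>v. Ck_on k S (\<lambda>x. frechet_derivative f (at x) v))"

definition smooth_on :: "'b::real_normed_vector set \<Rightarrow> ('b \<Rightarrow> 'c::real_normed_vector) \<Rightarrow> bool" where
  "smooth_on S f \<longleftrightarrow> (\<forall>k. Ck_on k S f)"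

section \<open>Smooth manifolds\<close>

text \<open>A chart is a pair of its domain and its coordinate map; the values of the coordinate map
  outside the domain are irrelevant.\<close>

type_synonym ('a, 'e) chart = "'a set \<times> ('a \<Rightarrow> 'e)"

abbreviation chart_dom :: "('a, 'e) chart \<Rightarrow> 'a set" where
  "chart_dom c \<equiv> fst c"

abbreviation chart_map :: "('a, 'e) chart \<Rightarrow> 'a \<Rightarrow> 'e" where
  "chart_map c \<equiv> snd c"

definition chart_inv :: "('a, 'e) chart \<Rightarrow> 'e \<Rightarrow> 'a" where
  "chart_inv c = inv_into (chart_dom c) (chart_map c)"

definition is_chart :: "'a topology \<Rightarrow> ('a, real ^ 'n) chart \<Rightarrow> bool" where
  "is_chart X c \<longleftrightarrow>
     openin X (chart_dom c) \<and> open (chart_map c ` chart_dom c) \<and>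
     homeomorphic_map (subtopology X (chart_dom c)) (top_of_set (chart_map c ` chart_dom c)) (chart_map c)"

definition local_rep :: "('a, 'e) chart \<Rightarrow> ('a \<Rightarrow> 'a) \<Rightarrow> ('a, 'e) chart \<Rightarrow> 'e \<Rightarrow> 'e" where
  "local_rep c F d = (\<lambda>x. chart_map d (F (chart_inv c x)))"

text \<open>The atlas is not required to be maximal; the smooth structure is the one it generates.\<close>

definition smooth_manifold :: "'a topology \<Rightarrow> ('a, real ^ 'n) chart set \<Rightarrow> bool" where
  "smooth_manifold X \<A> \<longleftrightarrow>
     Hausdorff_space X \<and> second_countable X \<and>
     (\<forall>c\<in>\<A>. is_chart X c) \<and> (\<Union>c\<in>\<A>. chart_dom c) = topspace X \<and>
     (\<forall>c\<in>\<A>. \<forall>d\<in>\<A>. smooth_on (chart_map c ` (chart_dom c \<inter> chart_dom d)) (local_rep c id d))"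

definition smooth_map :: "'a topology \<Rightarrow> ('a, real ^ 'n) chart set \<Rightarrow> ('a \<Rightarrow> 'a) \<Rightarrow> bool" where
  "smooth_map X \<A> F \<longleftrightarrow>
     continuous_map X X F \<and>
     (\<forall>c\<in>\<A>. \<forall>d\<in>\<A>. smooth_on (chart_map c ` {p \<in> chart_dom c. F p \<in> chart_dom d}) (local_rep c F d))"

definition diffeomorphism :: "'a topology \<Rightarrow> ('a, real ^ 'n) chart set \<Rightarrow> ('a \<Rightarrow> 'a) \<Rightarrow> bool" where
  "diffeomorphism X \<A> f \<longleftrightarrow>
     bij_betw f (topspace X) (topspace X) \<and>
     smooth_map X \<A> f \<and> smooth_map X \<A> (inv_into (topspace X) f)"

section \<open>Tangent vectors and differentials\<close>

text \<open>A tangent vector at \<open>p\<close> is the family of its coordinate vectors in all charts around \<open>p\<close>, which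
  are related by the derivatives of the transition maps; it is \<open>0\<close> at all other indices. Addition
  and scalar multiplication are pointwise.\<close>

type_synonym ('a, 'e) tangent = "('a, 'e) chart \<Rightarrow> 'e"

definition charts_at :: "('a, 'e) chart set \<Rightarrow> 'a \<Rightarrow> ('a, 'e) chart set" where
  "charts_at \<A> p = {c \<in> \<A>. p \<in> chart_dom c}"

definition tangent_space :: "('a, real ^ 'n) chart set \<Rightarrow> 'a \<Rightarrow> ('a, real ^ 'n) tangent set" where
  "tangent_space \<A> p =
     {\<xi>. (\<forall>c\<in>charts_at \<A> p. \<forall>d\<in>charts_at \<A> p.
            \<xi> d = frechet_derivative (local_rep c id d) (at (chart_map c p)) (\<xi> c)) \<and>
         (\<forall>c. c \<notin> charts_at \<A> p \<longrightarrow> \<xi> c = 0)}"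

text \<open>\<open>lift_vector \<A> c p v\<close> is the tangent vector at \<open>p\<close> with coordinate vector \<open>v\<close> in the chart \<open>c\<close>.\<close>

definition lift_vector ::
  "('a, real ^ 'n) chart set \<Rightarrow> ('a, real ^ 'n) chart \<Rightarrow> 'a \<Rightarrow> real ^ 'n \<Rightarrow> ('a, real ^ 'n) tangent" where
  "lift_vector \<A> c p v =
     (\<lambda>d. if d \<in> charts_at \<A> p
          then frechet_derivative (local_rep c id d) (at (chart_map c p)) v else 0)"

definition coord_vector ::
  "('a, real ^ 'n) chart set \<Rightarrow> ('a, real ^ 'n) chart \<Rightarrow> 'a \<Rightarrow> 'n \<Rightarrow> ('a, real ^ 'n) tangent" where
  "coord_vector \<A> c p i = lift_vector \<A> c p (axis i 1)"

text \<open>By the chain rule the choice of the chart \<open>c\<close> at \<open>p\<close> does not matter for smooth \<open>F\<close> and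
  \<open>\<xi>\<close> tangent at \<open>p\<close>.\<close>

definition differential ::
  "('a, real ^ 'n) chart set \<Rightarrow> ('a \<Rightarrow> 'a) \<Rightarrow> 'a \<Rightarrow> ('a, real ^ 'n) tangent \<Rightarrow> ('a, real ^ 'n) tangent" where
  "differential \<A> F p \<xi> =
     (let c = (SOME c. c \<in> charts_at \<A> p) in
      (\<lambda>d. if d \<in> charts_at \<A> (F p)
           then frechet_derivative (local_rep c F d) (at (chart_map c p)) (\<xi> c) else 0))"

section \<open>Riemannian metrics, top-degree forms and volume\<close>

type_synonym ('a, 'e) metric = "'a \<Rightarrow> ('a, 'e) tangent \<Rightarrow> ('a, 'e) tangent \<Rightarrow> real"

definition riemannian_metric ::
  "'a topology \<Rightarrow> ('a, real ^ 'n) chart set \<Rightarrow> ('a, real ^ 'n) metric \<Rightarrow> bool" where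
  "riemannian_metric X \<A> g \<longleftrightarrow>
     (\<forall>p\<in>topspace X.
        (\<forall>\<xi>\<in>tangent_space \<A> p. \<forall>\<eta>\<in>tangent_space \<A> p. g p \<xi> \<eta> = g p \<eta> \<xi>) \<and>
        (\<forall>\<xi>\<in>tangent_space \<A> p. \<forall>\<eta>\<in>tangent_space \<A> p. \<forall>\<zeta>\<in>tangent_space \<A> p. \<forall>a b.
           g p (\<lambda>c. a *\<^sub>R \<xi> c + b *\<^sub>R \<eta> c) \<zeta> = a * g p \<xi> \<zeta> + b * g p \<eta> \<zeta>) \<and>
        (\<forall>\<xi>\<in>tangent_space \<A> p. \<xi> \<noteq> (\<lambda>c. 0) \<longrightarrow> g p \<xi> \<xi> > 0)) \<and>
     (\<forall>c\<in>\<A>. \<forall>i j. smooth_on (chart_map c ` chart_dom c)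
        (\<lambda>x. g (chart_inv c x) (coord_vector \<A> c (chart_inv c x) i) (coord_vector \<A> c (chart_inv c x) j)))"

text \<open>Differential forms of degree \<open>n = dim M\<close>, as functions of \<open>n\<close>-tuples of tangent vectors indexed
  by \<open>'n\<close>.\<close>

type_synonym ('a, 'n) top_form = "'a \<Rightarrow> ('n \<Rightarrow> ('a, (real, 'n) vec) tangent) \<Rightarrow> real"

definition top_form ::
  "'a topology \<Rightarrow> ('a, real ^ 'n) chart set \<Rightarrow> ('a, 'n) top_form \<Rightarrow> bool" where
  "top_form X \<A> \<omega> \<longleftrightarrow>
     (\<forall>p\<in>topspace X. \<forall>\<xi>. (\<forall>i. \<xi> i \<in> tangent_space \<A> p) \<longrightarrow>
        (\<forall>i. \<forall>\<eta>\<in>tangent_space \<A> p. \<forall>\<zeta>\<in>tangent_space \<A> p. \<forall>a b.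
           \<omega> p (\<xi>(i := (\<lambda>c. a *\<^sub>R \<eta> c + b *\<^sub>R \<zeta> c))) = a * \<omega> p (\<xi>(i := \<eta>)) + b * \<omega> p (\<xi>(i := \<zeta>))) \<and>
        (\<forall>i j. i \<noteq> j \<and> \<xi> i = \<xi> j \<longrightarrow> \<omega> p \<xi> = 0)) \<and>
     (\<forall>c\<in>\<A>. smooth_on (chart_map c ` chart_dom c)
        (\<lambda>x. \<omega> (chart_inv c x) (coord_vector \<A> c (chart_inv c x))))"

definition orthonormal_frame ::
  "('a, real ^ 'n) chart set \<Rightarrow> ('a, real ^ 'n) metric \<Rightarrow> 'a \<Rightarrow> ('n \<Rightarrow> ('a, real ^ 'n) tangent) \<Rightarrow> bool" where
  "orthonormal_frame \<A> g p e \<longleftrightarrow>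
     (\<forall>i. e i \<in> tangent_space \<A> p) \<and> (\<forall>i j. g p (e i) (e j) = (if i = j then 1 else 0))"

text \<open>A Riemannian volume form takes the values \<open>1\<close> and \<open>-1\<close> on orthonormal frames. It is the volume
  form of \<open>g\<close> for the orientation whose positive frames are those on which it is positive;
  conversely every orientation arises this way.\<close>

definition riemannian_volume_form ::
  "'a topology \<Rightarrow> ('a, real ^ 'n) chart set \<Rightarrow> ('a, real ^ 'n) metric \<Rightarrow> ('a, 'n) top_form \<Rightarrow> bool" where
  "riemannian_volume_form X \<A> g \<omega> \<longleftrightarrow>
     top_form X \<A> \<omega> \<and>
     (\<forall>p\<in>topspace X. \<forall>e. orthonormal_frame \<A> g p e \<longrightarrow> \<bar>\<omega> p e\<bar> = 1)"

definition pullback_form ::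
  "('a, real ^ 'n) chart set \<Rightarrow> ('a \<Rightarrow> 'a) \<Rightarrow> ('a, 'n) top_form \<Rightarrow> ('a, 'n) top_form" where
  "pullback_form \<A> F \<omega> = (\<lambda>p \<xi>. \<omega> (F p) (\<lambda>i. differential \<A> F p (\<xi> i)))"

definition gram_matrix ::
  "('a, real ^ 'n) chart set \<Rightarrow> ('a, real ^ 'n) metric \<Rightarrow> ('a, real ^ 'n) chart \<Rightarrow> 'a \<Rightarrow> real ^ 'n ^ 'n" where
  "gram_matrix \<A> g c p = (\<chi> i j. g p (coord_vector \<A> c p i) (coord_vector \<A> c p j))"

text \<open>The volume of a set contained in the domain of the chart \<open>c\<close>.\<close>

definition chart_volume ::
  "('a, real ^ 'n) chart set \<Rightarrow> ('a, real ^ 'n) metric \<Rightarrow> ('a, real ^ 'n) chart \<Rightarrow> 'a set \<Rightarrow> ennreal" where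
  "chart_volume \<A> g c E =
     (\<integral>\<^sup>+x\<in>chart_map c ` E. ennreal (sqrt (det (gram_matrix \<A> g c (chart_inv c x)))) \<partial>lborel)"

text \<open>The Riemannian volume is a measure on the Borel sets of \<open>X\<close>. By second countability, countably
  many charts \<open>c n\<close> cover \<open>X\<close>. A Borel set is cut into disjoint pieces along such a cover; by the
  change of variables formula the result does not depend on it.\<close>

definition chart_cover :: "'a topology \<Rightarrow> ('a, 'e) chart set \<Rightarrow> (nat \<Rightarrow> ('a, 'e) chart) \<Rightarrow> bool" where
  "chart_cover X \<A> c \<longleftrightarrow> range c \<subseteq> \<A> \<and> (\<Union>n. chart_dom (c n)) = topspace X"

definition riemannian_volume ::
  "'a topology \<Rightarrow> ('a, real ^ 'n) chart set \<Rightarrow> ('a, real ^ 'n) metric \<Rightarrow> 'a measure" where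
  "riemannian_volume X \<A> g =
     (let c = (SOME c. chart_cover X \<A> c) in
      measure_of (topspace X) {U. openin X U}
        (\<lambda>E. \<Sum>n. chart_volume \<A> g (c n) (E \<inter> disjointed (\<lambda>m. chart_dom (c m)) n)))"

section \<open>Sequences tending to infinity\<close>

definition tends_to_infinity :: "'a topology \<Rightarrow> (nat \<Rightarrow> 'a) \<Rightarrow> bool" where
  "tends_to_infinity X x \<longleftrightarrow> (\<forall>K. compactin X K \<longrightarrow> (\<exists>N. \<forall>n\<ge>N. x n \<notin> K))"

definition backward_nonescaping :: "'a topology \<Rightarrow> ('a \<Rightarrow> 'a) \<Rightarrow> 'a set" where
  "backward_nonescaping X f =
     {x \<in> topspace X. \<not> tends_to_infinity X (\<lambda>n. (inv_into (topspace X) f ^^ n) x)}"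

end

theory Submission
  imports Defs
begin

text \<open>The volume form contracts under \<open>f\<close>: since \<open>f\<^sup>*V = A V\<close> with \<open>\<bar>A\<bar> \<le> a\<close>, the change of variables
  formula gives \<open>V(f(E)) \<le> a V(E)\<close> for every Borel set \<open>E\<close>, hence \<open>V(f\<^sup>n(L)) \<le> a\<^sup>n V(L)\<close>. A point \<open>x\<close>
  whose backward orbit returns infinitely often to \<open>L\<close> lies in \<open>f\<^sup>n(L)\<close> for infinitely many \<open>n\<close>. If
  \<open>V(L)\<close> is finite, then the geometric series converges and the Borel--Cantelli lemma shows that
  these points form a null set (\<open>backward_recurrent_null\<close>). A manifold is covered by countably many
  compact sets \<open>L k\<close> of finite volume such that finitely many of them cover any given compact set
  (\<open>compact_finite_volume_cover\<close>). If the backward orbit of \<open>x\<close> does not escape, it visits some compact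
  \<open>K\<close> infinitely often, and by the pigeonhole principle it visits a single \<open>L k\<close> infinitely often. So
  the non-escaping set is a countable union of null sets.

  The inequality \<open>V(f(E)) \<le> a V(E)\<close> (\<open>riemannian_volume_image_le\<close>) is where the geometry enters. The
  volume is an integral of \<open>sqrt (det G)\<close>, with \<open>G\<close> the Gram matrix of the coordinate vectors, whereas
  the hypothesis speaks of the volume form. The two agree up to sign
  (\<open>volume_density_eq_sqrt_det_gram\<close>): the form has absolute value \<open>1\<close> on orthonormal frames, and an
  alternating \<open>n\<close>-form on \<open>\<real>\<^sup>n\<close> is a multiple of the determinant. In coordinates the relation between \<open>f\<close>
  and \<open>A\<close> then says that the absolute Jacobian of \<open>f\<close> times the density at the image point is \<open>\<bar>A\<bar>\<close> times the
  density at the point (\<open>det_tangent_map_volume_density\<close>), which is exactly the integrand of the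
  change of variables formula. The same inequality for the identity, with \<open>A = a = 1\<close>, compares
  the volumes computed in different charts.\<close>

section \<open>Alternating forms and scalar products on Euclidean space\<close>

locale alternating_form =
  fixes D :: "('n::finite \<Rightarrow> real ^ 'n) \<Rightarrow> real"
  assumes linear_entry:
      "\<And>v i x y a b. D (v(i := a *\<^sub>R x + b *\<^sub>R y)) = a * D (v(i := x)) + b * D (v(i := y))"
    and equal_entries: "\<And>v i j. i \<noteq> j \<Longrightarrow> v i = v j \<Longrightarrow> D v = 0"
begin

lemma zero_entry:
  assumes "v i = 0"
  shows "D v = 0"
  using linear_entry[of v i 0 "v i" 0 "v i"] assms fun_upd_triv[of v i] by simp

lemma scale_entries: "D (\<lambda>i. c i *\<^sub>R v i) = prod c UNIV * D v"
proof -
  have "D (\<lambda>i. if i \<in> F then c i *\<^sub>R v i else v i) = prod c F * D v" if "finite F" for F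
    using that
  proof induction
    case (insert k F)
    let ?u = "\<lambda>i. if i \<in> F then c i *\<^sub>R v i else v i"
    have "(\<lambda>i. if i \<in> insert k F then c i *\<^sub>R v i else v i) = ?u(k := c k *\<^sub>R v k + 0 *\<^sub>R v k)"
      using insert.hyps by (auto simp: fun_eq_iff)
    moreover have "?u(k := v k) = ?u"
      using insert.hyps by (auto simp: fun_eq_iff)
    ultimately show ?case
      using linear_entry[of ?u k "c k" "v k" 0 "v k"] insert by simp
  qed auto
  from this[of UNIV] show ?thesis by simp
qed

text \<open>Polarization: the form vanishes when the entries \<open>m\<close> and \<open>n\<close> are both \<open>v m + v n\<close>, and expanding
  leaves the two mixed terms.\<close>

lemma swap_entries:
  assumes "m \<noteq> n"
  shows "D (\<lambda>i. v (Transposition.transpose m n i)) = - D v"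
proof -
  define w where "w x y = v(m := x, n := y)" for x y
  have add_m: "D (w (x + x') y) = D (w x y) + D (w x' y)" for x x' y
    using linear_entry[of "v(n := y)" m 1 x 1 x'] assms by (simp add: w_def fun_upd_twist)
  have add_n: "D (w x (y + y')) = D (w x y) + D (w x y')" for x y y'
    using linear_entry[of "v(m := x)" n 1 y 1 y'] by (simp add: w_def)
  have diag: "D (w x x) = 0" for x
    using equal_entries[of m n "w x x"] assms by (simp add: w_def)
  have "D (w (v m + v n) (v m + v n)) = D (w (v m) (v n)) + D (w (v n) (v m))"
    unfolding add_m add_n by (simp add: diag)
  then have "D (w (v n) (v m)) = - D (w (v m) (v n))"
    by (simp add: diag)
  moreover have "w (v m) (v n) = v" "w (v n) (v m) = (\<lambda>i. v (Transposition.transpose m n i))"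
    by (auto simp: w_def fun_eq_iff Transposition.transpose_def)
  ultimately show ?thesis by simp
qed

lemma add_multiple_entry:
  assumes "m \<noteq> n"
  shows "D (v(m := v m + c *\<^sub>R v n)) = D v"
proof -
  have "D (v(m := v n)) = 0"
    using equal_entries[of m n "v(m := v n)"] assms by simp
  then show ?thesis
    using linear_entry[of v m 1 "v m" c "v n"] by simp
qed

text \<open>If the claim holds for \<open>P\<close> and for \<open>Q\<close>, each with all \<open>B\<close>, then it holds for \<open>P ** Q\<close>. So it is enough
  to check the elementary matrices, where it is one of the rules for row operations above.\<close>

lemma matrix_action: "D (\<lambda>i. (P ** B) $ i) = det P * D (\<lambda>i. B $ i)"
proof (induction P arbitrary: B rule: induct_matrix_elementary)
  case (1 P Q)
  then show ?case
    by (simp add: matrix_mul_assoc[symmetric] det_mul)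
next
  case (2 P i)
  have "(P ** B) $ i = 0"
    using 2 by (simp add: matrix_matrix_mult_def row_def vec_eq_iff)
  then show ?case
    using zero_entry[of "\<lambda>i. (P ** B) $ i" i] det_zero_row(1)[OF 2] by simp
next
  case (3 P)
  have "(P ** B) $ i = (P $ i $ i) *\<^sub>R B $ i" for i
  proof -
    have "(P ** B) $ i $ j = (\<Sum>k\<in>UNIV. if k = i then P $ i $ i * B $ i $ j else 0)" for j
      unfolding matrix_matrix_mult_def using 3[of i]
      by (simp only: vec_lambda_beta, intro sum.cong) auto
    then show ?thesis by (simp add: vec_eq_iff)
  qed
  then have "(\<lambda>i. (P ** B) $ i) = (\<lambda>i. (P $ i $ i) *\<^sub>R B $ i)" by blast
  then show ?case
    using scale_entries[of "\<lambda>i. P $ i $ i" "\<lambda>i. B $ i"] by (simp add: det_diagonal[OF 3])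
next
  case (4 m n)
  let ?t = "Transposition.transpose m n"
  let ?P = "\<chi> i j. (mat 1 :: real ^ 'n ^ 'n) $ i $ ?t j"
  have "(?P ** B) $ i = B $ ?t i" for i
  proof -
    have "(?P ** B) $ i $ j = (\<Sum>k\<in>UNIV. if k = ?t i then B $ ?t i $ j else 0)" for j
      unfolding matrix_matrix_mult_def by (simp only: vec_lambda_beta, intro sum.cong)
        (auto simp: mat_def)
    then show ?thesis by (simp add: vec_eq_iff)
  qed
  then have "(\<lambda>i. (?P ** B) $ i) = (\<lambda>i. B $ ?t i)" by blast
  moreover have "det ?P = - 1"
    using det_permute_columns[of ?t "mat 1 :: real ^ 'n ^ 'n"] 4
    by (simp add: permutes_swap_id sign_swap_id)
  ultimately show ?case
    using swap_entries[OF 4, of "\<lambda>i. B $ i"] by simp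
next
  case (5 m n c)
  let ?P = "(\<chi> i j. if i = m \<and> j = n then c else of_bool (i = j)) :: real ^ 'n ^ 'n"
  have "(?P ** B) $ i = (if i = m then B $ m + c *\<^sub>R B $ n else B $ i)" for i
  proof (cases "i = m")
    case True
    have "(?P ** B) $ m $ j
        = (\<Sum>k\<in>UNIV. (if k = m then B $ m $ j else 0) + (if k = n then c * B $ n $ j else 0))" for j
      unfolding matrix_matrix_mult_def using 5 by (simp only: vec_lambda_beta, intro sum.cong) auto
    then show ?thesis
      using True by (simp add: vec_eq_iff sum.distrib)
  next
    case False
    have "(?P ** B) $ i $ j = (\<Sum>k\<in>UNIV. if k = i then B $ i $ j else 0)" for j
      unfolding matrix_matrix_mult_def using False
      by (simp only: vec_lambda_beta, intro sum.cong) auto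
    then show ?thesis
      using False by (simp add: vec_eq_iff)
  qed
  then have "(\<lambda>i. (?P ** B) $ i) = (\<lambda>i. B $ i)(m := B $ m + c *\<^sub>R B $ n)"
    by (auto simp: fun_eq_iff)
  moreover have "?P = (\<chi> k. if k = m then row m (mat 1) + c *s row n (mat 1) else row k (mat 1))"
    using 5 by (auto simp: vec_eq_iff row_def mat_def)
  then have "det ?P = 1"
    using det_row_operation[OF 5, of "mat 1 :: real ^ 'n ^ 'n" c] by simp
  ultimately show ?case
    using add_multiple_entry[OF 5, of "\<lambda>i. B $ i" c] by (simp only: mult_1)
qed

lemma eq_det: "D v = det (\<chi> i. v i) * D (\<lambda>i. axis i 1)"
proof -
  have "(\<lambda>i. (mat 1 :: real ^ 'n ^ 'n) $ i) = (\<lambda>i. axis i 1)"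
    by (auto simp: fun_eq_iff vec_eq_iff mat_def axis_def)
  then show ?thesis
    using matrix_action[of "\<chi> i. v i" "mat 1"] by simp
qed

end

locale scalar_product =
  fixes G :: "real ^ 'n \<Rightarrow> real ^ 'n \<Rightarrow> real"
  assumes bilinear: "bilinear G"
    and commute: "\<And>x y. G x y = G y x"
    and positive: "\<And>x. x \<noteq> 0 \<Longrightarrow> G x x > 0"
begin

lemma linear_left: "linear (\<lambda>x. G x y)" and linear_right: "linear (G x)"
  using bilinear by (auto simp: bilinear_def)

text \<open>Gram--Schmidt, by induction on the set of indices for which the vectors have been chosen: as long
  as an index is left, the chosen vectors do not span the space, and a vector outside their span can
  be made orthogonal to them and normalized.\<close>

lemma orthonormal_basis_exists:
  "\<exists>e :: 'n \<Rightarrow> real ^ 'n. \<forall>i j. G (e i) (e j) = (if i = j then 1 else 0)"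
proof -
  have "\<exists>e :: 'n \<Rightarrow> real ^ 'n. \<forall>i\<in>F. \<forall>j\<in>F. G (e i) (e j) = (if i = j then 1 else 0)"
    if "finite F" for F :: "'n set"
    using that
  proof induction
    case (insert k F)
    then obtain e :: "'n \<Rightarrow> real ^ 'n"
      where e: "\<And>i j. i \<in> F \<Longrightarrow> j \<in> F \<Longrightarrow> G (e i) (e j) = (if i = j then 1 else 0)" by blast
    have "dim (e ` F) \<le> card F"
      using insert.hyps by (meson card_image_le dim_le_card' finite_imageI order_trans)
    also have "card F < DIM(real ^ 'n)"
      using insert.hyps psubset_card_mono[of UNIV F] by auto
    finally have "span (e ` F) \<noteq> UNIV"
      by (metis dim_span dim_UNIV less_irrefl)
    then obtain v where v: "v \<notin> span (e ` F)" by blast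
    define w where "w = v - (\<Sum>i\<in>F. G v (e i) *\<^sub>R e i)"
    have "(\<Sum>i\<in>F. G v (e i) *\<^sub>R e i) \<in> span (e ` F)"
      by (intro span_sum span_scale span_base) auto
    with v have "w \<noteq> 0" by (auto simp: w_def)
    then have pos: "G w w > 0" by (rule positive)
    have orth: "G w (e j) = 0" if "j \<in> F" for j
    proof -
      have "G w (e j) = G v (e j) - (\<Sum>i\<in>F. G v (e i) * G (e i) (e j))"
        unfolding w_def
        by (simp add: linear_diff[OF linear_left] linear_sum[OF linear_left] linear_cmul[OF linear_left])
      also have "(\<Sum>i\<in>F. G v (e i) * G (e i) (e j)) = (\<Sum>i\<in>F. if i = j then G v (e j) else 0)"
        by (intro sum.cong) (auto simp: e that)
      finally show ?thesis using that insert.hyps by simp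
    qed
    define u where "u = (1 / sqrt (G w w)) *\<^sub>R w"
    have "G u u = 1"
      using pos by (simp add: u_def linear_cmul[OF linear_left] linear_cmul[OF linear_right])
    moreover have "G u (e j) = 0" "G (e j) u = 0" if "j \<in> F" for j
      using orth[OF that] commute[of "e j" u] by (simp_all add: u_def linear_cmul[OF linear_left])
    ultimately show ?case
      using insert.hyps e by (intro exI[of _ "e(k := u)"]) auto
  qed auto
  from this[of UNIV] show ?thesis by auto
qed

text \<open>If the rows of \<open>P\<close> are an orthonormal basis and \<open>Q\<close> is the Gram matrix of the standard basis, then
  \<open>P Q P\<^sup>T = 1\<close>, while \<open>D\<close> takes the value \<open>det P * D(axes)\<close> on the basis. So both \<open>det Q\<close> and the
  square of \<open>D(axes)\<close> are the inverse of \<open>(det P)\<^sup>2\<close>.\<close>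

lemma alternating_form_sqrt_Gram:
  assumes "alternating_form D"
    and unit: "\<And>e. (\<And>i j. G (e i) (e j) = (if i = j then 1 else 0)) \<Longrightarrow> \<bar>D e\<bar> = 1"
  shows "\<bar>D (\<lambda>i. axis i 1)\<bar> = sqrt (det (\<chi> i j. G (axis i 1) (axis j 1)))"
proof -
  interpret alternating_form D by fact
  obtain e :: "'n \<Rightarrow> real ^ 'n" where e: "\<And>i j. G (e i) (e j) = (if i = j then 1 else 0)"
    using orthonormal_basis_exists by blast
  define P :: "real ^ 'n ^ 'n" where "P = (\<chi> i. e i)"
  define Q :: "real ^ 'n ^ 'n" where "Q = (\<chi> i j. G (axis i 1) (axis j 1))"
  have expand: "x = (\<Sum>k\<in>UNIV. x $ k *\<^sub>R axis k 1)" for x :: "real ^ 'n"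
    using basis_expansion[of x] by (simp add: scalar_mult_eq_scaleR)
  have "(P ** Q ** transpose P) $ i $ j = (mat 1 :: real ^ 'n ^ 'n) $ i $ j" for i j
  proof -
    have "G (e i) (e j)
        = G (\<Sum>k\<in>UNIV. e i $ k *\<^sub>R axis k 1) (\<Sum>l\<in>UNIV. e j $ l *\<^sub>R axis l 1)"
      by (rule arg_cong2[where f = G, OF expand expand])
    also have "\<dots> = (\<Sum>l\<in>UNIV. \<Sum>k\<in>UNIV. e i $ k * (e j $ l * G (axis k 1) (axis l 1)))"
      by (simp add: linear_sum[OF linear_right] linear_sum[OF linear_left]
          linear_cmul[OF linear_right] linear_cmul[OF linear_left] sum_distrib_left mult.left_commute)
    also have "\<dots> = (P ** Q ** transpose P) $ i $ j"
      by (simp add: matrix_matrix_mult_def P_def Q_def transpose_def sum_distrib_left ac_simps)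
    finally show ?thesis by (simp add: e mat_def)
  qed
  then have "P ** Q ** transpose P = mat 1" by (simp add: vec_eq_iff)
  then have "det (P ** Q ** transpose P) = 1" by simp
  then have 1: "(det P)\<^sup>2 * det Q = 1"
    by (simp add: det_mul power2_eq_square ac_simps)
  have "1 = \<bar>det P\<bar> * \<bar>D (\<lambda>i. axis i 1)\<bar>"
    using unit[OF e] eq_det[of e] by (simp add: P_def abs_mult)
  then have "(\<bar>det P\<bar> * \<bar>D (\<lambda>i. axis i 1)\<bar>)\<^sup>2 = 1" by simp
  then have "(det P)\<^sup>2 * (D (\<lambda>i. axis i 1))\<^sup>2 = 1" by (simp add: power_mult_distrib)
  with 1 have "det Q = (D (\<lambda>i. axis i 1))\<^sup>2"
    by (metis mult_cancel_left mult_zero_left zero_neq_one)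
  then show ?thesis by (simp add: Q_def)
qed

end

section \<open>Change of variables as an inequality for nonnegative integrals\<close>

text \<open>One half of the change of variables formula for nonnegative functions. If the right-hand side is infinite there
  is nothing to show, and otherwise its integrand is absolutely integrable.\<close>

lemma nn_integral_image_le_wellordered:
  fixes g :: "real ^ 'm::{finite,wellorder} \<Rightarrow> real ^ 'm::_"
  assumes S: "S \<in> sets borel"
    and der: "\<And>x. x \<in> S \<Longrightarrow> (g has_derivative g' x) (at x within S)"
    and inj: "inj_on g S"
    and h: "h \<in> borel_measurable borel" "\<And>x. 0 \<le> h x"
  shows "(\<integral>\<^sup>+x\<in>g ` S. ennreal (h x) \<partial>lborel)
    \<le> (\<integral>\<^sup>+x\<in>S. ennreal (\<bar>det (matrix (g' x))\<bar> * h (g x)) \<partial>lborel)"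
proof (cases "(\<integral>\<^sup>+x\<in>S. ennreal (\<bar>det (matrix (g' x))\<bar> * h (g x)) \<partial>lborel) = \<infinity>")
  case False
  let ?J = "\<lambda>x. \<bar>det (matrix (g' x))\<bar> * h (g x)"
  have SL: "S \<in> sets lebesgue" using S by simp
  have "continuous_on S g"
    using der has_derivative_continuous_on by blast
  then have "g \<in> borel_measurable (lebesgue_on S)"
    using SL by (rule continuous_imp_measurable_on_sets_lebesgue)
  then have "(\<lambda>x. h (g x)) \<in> borel_measurable (lebesgue_on S)"
    using h(1) by measurable
  moreover have "(\<lambda>x. det (matrix (g' x))) \<in> borel_measurable (lebesgue_on S)"
    using SL der by (rule borel_measurable_det_Jacobian)
  ultimately have "?J \<in> borel_measurable (lebesgue_on S)" by measurable
  then have meas: "(\<lambda>x. if x \<in> S then ?J x else 0) \<in> borel_measurable lebesgue"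
    using SL by (simp add: borel_measurable_if)
  have ind: "(\<lambda>x. indicator S x *\<^sub>R ?J x) = (\<lambda>x. if x \<in> S then ?J x else 0)"
    by (auto simp: fun_eq_iff indicator_def)
  have "(\<integral>\<^sup>+x. ennreal (if x \<in> S then ?J x else 0) \<partial>lebesgue)
      = (\<integral>\<^sup>+x\<in>S. ennreal (?J x) \<partial>lborel)"
    unfolding nn_integral_completion by (intro nn_integral_cong) auto
  then have "integrable lebesgue (\<lambda>x. if x \<in> S then ?J x else 0)"
    using False meas h(2) by (intro integrableI_nonneg) (auto simp: less_top)
  then have J: "?J absolutely_integrable_on S"
    unfolding set_integrable_def ind .
  then have "(\<lambda>x. \<bar>det (matrix (g' x))\<bar> *\<^sub>R (vec (h (g x)) :: real ^ 1)) absolutely_integrable_on S"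
    by (simp add: absolutely_integrable_on_1_iff)
  then have im: "(\<lambda>x. vec (h x) :: real ^ 1) absolutely_integrable_on g ` S"
    and eq: "integral (g ` S) (\<lambda>x. vec (h x) :: real ^ 1)
      = integral S (\<lambda>x. \<bar>det (matrix (g' x))\<bar> *\<^sub>R (vec (h (g x)) :: real ^ 1))"
    using has_absolute_integral_change_of_variables[OF SL der inj, of "\<lambda>x. vec (h x) :: real ^ 1"]
    by blast+
  from im have H: "h absolutely_integrable_on g ` S"
    by (simp add: absolutely_integrable_on_1_iff)
  have "integral (g ` S) h = integral S ?J"
    using arg_cong[OF eq, of "\<lambda>v. v $ 1"] by (simp add: integral_on_1_eq)
  moreover have "(h has_integral integral (g ` S) h) (g ` S)" "(?J has_integral integral S ?J) S"
    using H J by (auto simp: absolutely_integrable_on_def integrable_integral)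
  from nn_integral_has_integral_lebesgue[OF _ this(1)] nn_integral_has_integral_lebesgue[OF _ this(2)]
  have "integral\<^sup>N lborel (\<lambda>x. indicator (g ` S) x * h x) = integral (g ` S) h"
      "integral\<^sup>N lborel (\<lambda>x. indicator S x * ?J x) = integral S ?J"
    using h(2) by auto
  moreover have "integral\<^sup>N lborel (\<lambda>x. indicator A x * f x) = (\<integral>\<^sup>+x\<in>A. ennreal (f x) \<partial>lborel)"
    for A and f :: "real ^ 'm::_ \<Rightarrow> real"
    by (intro nn_integral_cong) (auto simp: indicator_def)
  ultimately show ?thesis by simp
qed simp

text \<open>The index type of the coordinates needs a well-order in the formula above. Volumes and determinants
  do not change when the coordinates are renamed, so it extends to every finite index type along
  the renaming of coordinates to a well-ordered copy of that type.\<close>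

typedef 'n ordered_index = "UNIV :: 'n set" by auto

instance ordered_index :: (finite) finite
proof
  have "(UNIV :: 'a ordered_index set) = range Abs_ordered_index"
    by (metis Rep_ordered_index_inverse surj_def)
  then show "finite (UNIV :: 'a ordered_index set)"
    by (metis finite finite_imageI)
qed

instantiation ordered_index :: (finite) wellorder
begin

definition "x \<le> y \<longleftrightarrow>
  to_nat_on UNIV (Rep_ordered_index x) \<le> to_nat_on UNIV (Rep_ordered_index y)"

definition "x < y \<longleftrightarrow>
  to_nat_on UNIV (Rep_ordered_index x) < to_nat_on UNIV (Rep_ordered_index y)"

instance
proof
  have inj: "x = y" if "to_nat_on UNIV (Rep_ordered_index x) = to_nat_on UNIV (Rep_ordered_index y)"
    for x y :: "'a ordered_index"
    using that inj_on_to_nat_on[of "UNIV :: 'a set"]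
    by (auto simp: countable_finite inj_def Rep_ordered_index_inject)
  show "x = y" if "x \<le> y" "y \<le> x" for x y :: "'a ordered_index"
    using that inj by (simp add: less_eq_ordered_index_def)
  show "P a" if "\<And>x. (\<And>y. y < x \<Longrightarrow> P y) \<Longrightarrow> P x" for P and a :: "'a ordered_index"
    using that unfolding less_ordered_index_def
    by (rule measure_induct_rule[where f = "\<lambda>x. to_nat_on UNIV (Rep_ordered_index x)"])
qed (auto simp: less_eq_ordered_index_def less_ordered_index_def)

end

definition reindex :: "real ^ 'n \<Rightarrow> real ^ 'n ordered_index" where
  "reindex x = (\<chi> i. x $ Rep_ordered_index i)"

definition unindex :: "real ^ 'n ordered_index \<Rightarrow> real ^ 'n" where
  "unindex y = (\<chi> i. y $ Abs_ordered_index i)"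

lemma reindex_unindex [simp]: "reindex (unindex y) = y" "unindex (reindex x) = x"
  by (simp_all add: reindex_def unindex_def vec_eq_iff Rep_ordered_index_inverse Abs_ordered_index_inverse)

lemma reindex_eq_iff [simp]: "reindex x = reindex y \<longleftrightarrow> x = y"
  by (metis reindex_unindex(2))

lemma linear_reindex: "linear reindex" and linear_unindex: "linear unindex"
  by (auto simp: linear_iff reindex_def unindex_def vec_eq_iff)

lemma borel_measurable_reindex [measurable]: "reindex \<in> borel_measurable borel"
  and borel_measurable_unindex [measurable]: "unindex \<in> borel_measurable borel"
  by (simp_all add: borel_measurable_continuous_onI linear_continuous_on linear_reindex linear_unindex
      flip: linear_conv_bounded_linear)

lemma prod_Basis_cart: "(\<Prod>b\<in>Basis. x \<bullet> b) = (\<Prod>i\<in>UNIV. (x :: real ^ 'n) $ i)"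
proof -
  have "inj (\<lambda>i. axis i 1 :: real ^ 'n)" by (auto simp: inj_def axis_eq_axis)
  moreover have "(Basis :: (real ^ 'n) set) = range (\<lambda>i. axis i 1)" by (auto simp: Basis_vec_def)
  ultimately show ?thesis
    by (metis (no_types, lifting) cart_eq_inner_axis comp_apply prod.cong prod.reindex)
qed

lemma lborel_reindex: "distr lborel borel reindex = (lborel :: (real, ('n::finite) ordered_index) vec measure)"
proof (rule lborel_eqI[symmetric])
  fix l u :: "real ^ 'n ordered_index"
  assume le: "\<And>b. b \<in> Basis \<Longrightarrow> l \<bullet> b \<le> u \<bullet> b"
  have le': "unindex l \<bullet> b \<le> unindex u \<bullet> b" if b: "b \<in> Basis" for b
  proof -
    obtain i where "b = axis i 1" using b by (auto simp: Basis_vec_def)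
    moreover have "(axis (Abs_ordered_index i) 1 :: real ^ 'n ordered_index) \<in> Basis"
      by (simp add: axis_in_Basis_iff)
    from le[OF this] have "unindex l $ i \<le> unindex u $ i"
      by (simp add: unindex_def inner_axis)
    ultimately show ?thesis by (simp add: inner_axis)
  qed
  have "reindex -` box l u = box (unindex l) (unindex u)"
  proof -
    have "(\<forall>i. l $ i < x $ Rep_ordered_index i \<and> x $ Rep_ordered_index i < u $ i)
      \<longleftrightarrow> (\<forall>j. l $ Abs_ordered_index j < x $ j \<and> x $ j < u $ Abs_ordered_index j)" for x :: "real ^ 'n"
      by (metis Abs_ordered_index_inverse Rep_ordered_index_inverse UNIV_I)
    then show ?thesis by (auto simp: mem_box_cart reindex_def unindex_def)
  qed
  then have "emeasure (distr lborel borel reindex) (box l u)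
      = (\<Prod>b\<in>Basis. (unindex u - unindex l) \<bullet> b)"
    using le' by (simp add: emeasure_distr emeasure_lborel_box)
  also have "(\<Prod>b\<in>Basis. (unindex u - unindex l) \<bullet> b) = (\<Prod>b\<in>Basis. (u - l) \<bullet> b)"
    unfolding prod_Basis_cart
    by (rule prod.reindex_bij_witness[of _ Rep_ordered_index Abs_ordered_index])
      (auto simp: Rep_ordered_index_inverse Abs_ordered_index_inverse unindex_def)
  finally show "emeasure (distr lborel borel reindex) (box l u) = (\<Prod>b\<in>Basis. (u - l) \<bullet> b)" .
qed simp

text \<open>The left-hand side is an alternating form in the rows of \<open>P\<close> with value \<open>1\<close> on the identity matrix.\<close>

lemma det_reindex:
  fixes P :: "real ^ 'n ^ 'n"
  shows "det (\<chi> i j. P $ Rep_ordered_index i $ Rep_ordered_index j) = det P"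
proof -
  define D :: "('n \<Rightarrow> real ^ 'n) \<Rightarrow> real"
    where "D v = det (\<chi> i. reindex (v (Rep_ordered_index i)))" for v
  interpret alternating_form D
  proof
    fix v :: "'n \<Rightarrow> real ^ 'n" and i :: 'n and x y :: "real ^ 'n" and a b :: real
    let ?k = "Abs_ordered_index i" and ?w = "\<lambda>j. reindex (v (Rep_ordered_index j))"
    have upd: "D (v(i := z)) = det (\<chi> j. if j = ?k then reindex z else ?w j)" for z
      unfolding D_def
      by (intro arg_cong[where f = det])
        (auto simp: vec_eq_iff Abs_ordered_index_inverse Rep_ordered_index_inverse)
    have lin: "reindex (a *\<^sub>R x + b *\<^sub>R y) = a *s reindex x + b *s reindex y"
      by (simp add: linear_add[OF linear_reindex] linear_cmul[OF linear_reindex] scalar_mult_eq_scaleR)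
    show "D (v(i := a *\<^sub>R x + b *\<^sub>R y)) = a * D (v(i := x)) + b * D (v(i := y))"
      using det_row_add[of ?k "\<lambda>_. a *s reindex x" "\<lambda>_. b *s reindex y" ?w]
        det_row_mul[of ?k a "\<lambda>_. reindex x" ?w] det_row_mul[of ?k b "\<lambda>_. reindex y" ?w]
      unfolding upd lin by simp
  next
    fix v :: "'n \<Rightarrow> real ^ 'n" and i j :: 'n
    assume "i \<noteq> j" "v i = v j"
    then show "D v = 0"
      unfolding D_def
      by (intro det_identical_rows[of "Abs_ordered_index i" "Abs_ordered_index j"])
        (auto simp: row_def Abs_ordered_index_inverse Abs_ordered_index_inject)
  qed
  have "D (\<lambda>i. axis i 1) = det (mat 1 :: real ^ 'n ordered_index ^ 'n ordered_index)"
    unfolding D_def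
    by (intro arg_cong[where f = det])
      (auto simp: vec_eq_iff reindex_def axis_def mat_def Rep_ordered_index_inject)
  then show ?thesis
    using eq_det[of "\<lambda>i. P $ i"] by (simp add: D_def reindex_def)
qed

lemma det_matrix_reindex:
  fixes f :: "real ^ 'n \<Rightarrow> real ^ 'n"
  assumes "linear f"
  shows "det (matrix (\<lambda>y. reindex (f (unindex y)))) = det (matrix f)"
proof -
  have "unindex (axis j 1) = axis (Rep_ordered_index j) (1 :: real)" for j :: "'n ordered_index"
    by (auto simp: unindex_def vec_eq_iff axis_def Rep_ordered_index_inverse Abs_ordered_index_inverse)
  then have "matrix (\<lambda>y. reindex (f (unindex y)))
      = (\<chi> i j. matrix f $ Rep_ordered_index i $ Rep_ordered_index j)"
    by (intro vec_eq_iff[THEN iffD2] allI) (simp add: matrix_def reindex_def)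
  then show ?thesis by (simp add: det_reindex)
qed

text \<open>The measurable majorant \<open>k\<close> of the transformed integrand stands in for the integrand, which need not be Borel
  measurable because \<open>g'\<close> is an arbitrary choice of derivatives.\<close>

lemma nn_integral_image_le:
  fixes g :: "real ^ 'n \<Rightarrow> real ^ 'n"
  assumes S: "S \<in> sets borel" "g ` S \<in> sets borel"
    and der: "\<And>x. x \<in> S \<Longrightarrow> (g has_derivative g' x) (at x within S)"
    and inj: "inj_on g S"
    and h: "h \<in> borel_measurable borel" "\<And>x. 0 \<le> h x"
    and k: "k \<in> borel_measurable borel"
      "\<And>x. x \<in> S \<Longrightarrow> ennreal (\<bar>det (matrix (g' x))\<bar> * h (g x)) \<le> k x"
  shows "(\<integral>\<^sup>+x\<in>g ` S. ennreal (h x) \<partial>lborel) \<le> (\<integral>\<^sup>+x\<in>S. k x \<partial>lborel)"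
proof -
  let ?g = "\<lambda>y. reindex (g (unindex y))"
  have image: "reindex ` A = unindex -` A" for A :: "(real ^ 'n) set"
  proof
    show "unindex -` A \<subseteq> reindex ` A"
    proof
      fix y assume "y \<in> unindex -` A"
      then have "reindex (unindex y) \<in> reindex ` A" by blast
      then show "y \<in> reindex ` A" by simp
    qed
  qed auto
  have borel_image: "reindex ` A \<in> sets borel" if "A \<in> sets borel" for A :: "(real ^ 'n) set"
    unfolding image using measurable_sets[OF borel_measurable_unindex that] by simp
  have transfer: "(\<integral>\<^sup>+x\<in>A. f x \<partial>lborel) = (\<integral>\<^sup>+y\<in>reindex ` A. f (unindex y) \<partial>lborel)"
    if [measurable]: "A \<in> sets borel" "f \<in> borel_measurable borel"
    for A :: "(real ^ 'n) set" and f :: "real ^ 'n \<Rightarrow> ennreal"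
  proof -
    note [measurable] = borel_image[OF that(1)]
    have "(\<integral>\<^sup>+y\<in>reindex ` A. f (unindex y) \<partial>distr lborel borel reindex)
        = (\<integral>\<^sup>+x. f x * indicator (reindex ` A) (reindex x) \<partial>lborel)"
      by (subst nn_integral_distr) simp_all
    also have "\<dots> = (\<integral>\<^sup>+x\<in>A. f x \<partial>lborel)"
      by (intro nn_integral_cong) (simp add: image indicator_def)
    finally show ?thesis by (simp add: lborel_reindex)
  qed
  have der': "(?g has_derivative (\<lambda>y. reindex (g' (unindex x) (unindex y)))) (at x within reindex ` S)"
    if "x \<in> reindex ` S" for x
  proof -
    have "unindex ` reindex ` S = S" by (simp add: image_image)
    moreover have "unindex x \<in> S" using that by auto
    ultimately have "(g has_derivative g' (unindex x)) (at (unindex x) within unindex ` reindex ` S)"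
      using der by simp
    from has_derivative_in_compose[OF linear_imp_has_derivative[OF linear_unindex] this]
    have "((\<lambda>y. g (unindex y)) has_derivative (\<lambda>y. g' (unindex x) (unindex y))) (at x within reindex ` S)" .
    from linear_imp_has_derivative[OF linear_reindex, THEN has_derivative_compose[OF this]]
    show ?thesis .
  qed
  have "(\<integral>\<^sup>+x\<in>g ` S. ennreal (h x) \<partial>lborel)
      = (\<integral>\<^sup>+y\<in>?g ` reindex ` S. ennreal (h (unindex y)) \<partial>lborel)"
    using S h by (subst transfer) (simp_all add: image_image)
  also have "\<dots> \<le> (\<integral>\<^sup>+y\<in>reindex ` S.
      ennreal (\<bar>det (matrix (\<lambda>z. reindex (g' (unindex y) (unindex z))))\<bar> * h (unindex (?g y))) \<partial>lborel)"
  proof (rule nn_integral_image_le_wellordered)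
    show "inj_on ?g (reindex ` S)"
      using inj unfolding inj_on_def by auto
  qed (use S h der' borel_image in auto)
  also have "\<dots> \<le> (\<integral>\<^sup>+y\<in>reindex ` S. k (unindex y) \<partial>lborel)"
  proof (intro nn_integral_mono)
    fix y :: "real ^ 'n ordered_index"
    have "linear (g' (unindex y))" if "y \<in> reindex ` S"
      using that der has_derivative_linear by force
    then show "ennreal (\<bar>det (matrix (\<lambda>z. reindex (g' (unindex y) (unindex z))))\<bar> * h (unindex (?g y)))
        * indicator (reindex ` S) y \<le> k (unindex y) * indicator (reindex ` S) y"
      using k(2) by (auto simp: indicator_def det_matrix_reindex)
  qed
  also have "\<dots> = (\<integral>\<^sup>+x\<in>S. k x \<partial>lborel)"
    using S k by (subst transfer) simp_all
  finally show ?thesis .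
qed

section \<open>Tangent vectors and volume forms in coordinates\<close>

lemma smooth_on_imp_continuous_on: "smooth_on S f \<Longrightarrow> continuous_on S f"
  by (metis Ck_on.simps(1) smooth_on_def)

lemma smooth_on_has_frechet_derivative:
  assumes "open S" "smooth_on S f" "x \<in> S"
  shows "(f has_derivative frechet_derivative f (at x)) (at x)"
proof -
  have "Ck_on (Suc 0) S f" using assms(2) unfolding smooth_on_def by blast
  then have "f differentiable_on S" by (simp only: Ck_on.simps)
  then have "f differentiable at x within S"
    using assms(3) unfolding differentiable_on_def by blast
  then show ?thesis
    using at_within_open[OF assms(3,1)] frechet_derivative_works by metis
qed

locale manifold =
  fixes X :: "'a topology" and \<A> :: "('a, real ^ 'n) chart set"
  assumes smooth_manifold: "smooth_manifold X \<A>"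
begin

abbreviation chart_range :: "('a, real ^ 'n) chart \<Rightarrow> (real ^ 'n) set" where
  "chart_range c \<equiv> chart_map c ` chart_dom c"

abbreviation lift :: "('a, real ^ 'n) chart \<Rightarrow> 'a \<Rightarrow> real ^ 'n \<Rightarrow> ('a, real ^ 'n) tangent" where
  "lift \<equiv> lift_vector \<A>"

lemma is_chart: "c \<in> \<A> \<Longrightarrow> is_chart X c"
  using smooth_manifold by (simp add: smooth_manifold_def)

lemma openin_chart_dom: "c \<in> \<A> \<Longrightarrow> openin X (chart_dom c)"
  and open_chart_range: "c \<in> \<A> \<Longrightarrow> open (chart_range c)"
  using is_chart by (auto simp: is_chart_def)

lemma chart_dom_subset: "c \<in> \<A> \<Longrightarrow> chart_dom c \<subseteq> topspace X"
  by (simp add: openin_chart_dom openin_subset)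

lemma homeomorphic_chart_map:
  "c \<in> \<A> \<Longrightarrow> homeomorphic_map (subtopology X (chart_dom c)) (top_of_set (chart_range c)) (chart_map c)"
  using is_chart by (auto simp: is_chart_def)

lemma inj_on_chart_map:
  assumes "c \<in> \<A>"
  shows "inj_on (chart_map c) (chart_dom c)"
proof -
  have "topspace (subtopology X (chart_dom c)) = chart_dom c"
    using chart_dom_subset[OF assms] by auto
  then show ?thesis
    using homeomorphic_imp_injective_map[OF homeomorphic_chart_map[OF assms]] by simp
qed

lemma chart_inv_chart_map [simp]:
  "c \<in> \<A> \<Longrightarrow> p \<in> chart_dom c \<Longrightarrow> chart_inv c (chart_map c p) = p"
  by (simp add: chart_inv_def inj_on_chart_map)

lemma chart_inv_in_dom: "x \<in> chart_range c \<Longrightarrow> chart_inv c x \<in> chart_dom c"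
  and chart_map_chart_inv: "x \<in> chart_range c \<Longrightarrow> chart_map c (chart_inv c x) = x"
  by (simp_all add: chart_inv_def inv_into_into f_inv_into_f)

lemma continuous_chart_inv:
  assumes "c \<in> \<A>"
  shows "continuous_map (top_of_set (chart_range c)) X (chart_inv c)"
proof -
  obtain h where h: "homeomorphic_maps (subtopology X (chart_dom c)) (top_of_set (chart_range c)) (chart_map c) h"
    using homeomorphic_chart_map[OF assms] by (auto simp: homeomorphic_map_maps)
  have "h x = chart_inv c x" if "x \<in> topspace (top_of_set (chart_range c))" for x
  proof -
    from that obtain p where p: "p \<in> chart_dom c" "x = chart_map c p" by auto
    with h show ?thesis
      using assms chart_dom_subset[OF assms] by (auto simp: homeomorphic_maps_def)
  qed
  moreover have "continuous_map (top_of_set (chart_range c)) X h"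
    using h by (simp add: homeomorphic_maps_def continuous_map_in_subtopology)
  ultimately show ?thesis by (rule continuous_map_eq[rotated])
qed

lemma open_chart_image:
  assumes "c \<in> \<A>" "openin X W"
  shows "open (chart_map c ` (chart_dom c \<inter> W))"
proof -
  have "openin (subtopology X (chart_dom c)) (chart_dom c \<inter> W)"
    using assms by (metis openin_subtopology_Int2)
  then have "openin (top_of_set (chart_range c)) (chart_map c ` (chart_dom c \<inter> W))"
    using homeomorphic_imp_open_map[OF homeomorphic_chart_map[OF assms(1)]]
    by (auto simp: open_map_def)
  then show ?thesis
    using open_chart_range[OF assms(1)] openin_open_trans by blast
qed

lemma open_local_rep_domain:
  assumes "c \<in> \<A>" "d \<in> \<A>" "continuous_map X X F"
  shows "open (chart_map c ` {p \<in> chart_dom c. F p \<in> chart_dom d})"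
proof -
  have "{p \<in> chart_dom c. F p \<in> chart_dom d} = chart_dom c \<inter> {p \<in> topspace X. F p \<in> chart_dom d}"
    using chart_dom_subset[OF assms(1)] by auto
  then show ?thesis
    using open_chart_image[OF assms(1) openin_continuous_map_preimage[OF assms(3) openin_chart_dom]]
      assms(2) by simp
qed

abbreviation tangent_map ::
  "('a, real ^ 'n) chart \<Rightarrow> ('a \<Rightarrow> 'a) \<Rightarrow> ('a, real ^ 'n) chart \<Rightarrow> 'a \<Rightarrow> real ^ 'n \<Rightarrow> real ^ 'n" where
  "tangent_map c F d p \<equiv> frechet_derivative (local_rep c F d) (at (chart_map c p))"

lemma local_rep_has_derivative:
  assumes "smooth_map X \<A> F" "c \<in> \<A>" "d \<in> \<A>" "p \<in> chart_dom c" "F p \<in> chart_dom d"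
  shows "(local_rep c F d has_derivative tangent_map c F d p) (at (chart_map c p))"
proof (rule smooth_on_has_frechet_derivative)
  let ?S = "chart_map c ` {p \<in> chart_dom c. F p \<in> chart_dom d}"
  show "open ?S"
    using assms by (intro open_local_rep_domain) (simp_all add: smooth_map_def)
  show "smooth_on ?S (local_rep c F d)"
    using assms unfolding smooth_map_def by blast
  show "chart_map c p \<in> ?S"
    using assms by blast
qed

lemma smooth_map_id: "smooth_map X \<A> id"
proof -
  have "smooth_on (chart_map c ` {p \<in> chart_dom c. id p \<in> chart_dom d}) (local_rep c id d)"
    if "c \<in> \<A>" "d \<in> \<A>" for c d
  proof -
    have "{p \<in> chart_dom c. id p \<in> chart_dom d} = chart_dom c \<inter> chart_dom d" by auto
    moreover have "smooth_on (chart_map c ` (chart_dom c \<inter> chart_dom d)) (local_rep c id d)"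
      using smooth_manifold that unfolding smooth_manifold_def by blast
    ultimately show ?thesis by (simp only:)
  qed
  then show ?thesis
    unfolding smooth_map_def by (simp add: id_def)
qed

text \<open>The chain rule for coordinate representations. With one of the two maps the identity, it expresses
  independence of the chart.\<close>

lemma tangent_map_compose:
  assumes F: "smooth_map X \<A> F" and H: "smooth_map X \<A> H"
    and charts: "c \<in> \<A>" "d \<in> \<A>" "e \<in> \<A>"
    and p: "p \<in> chart_dom c" "H p \<in> chart_dom d" "F (H p) \<in> chart_dom e"
  shows "tangent_map c (F \<circ> H) e p v = tangent_map d F e (H p) (tangent_map c H d p v)"
proof -
  let ?S = "chart_map c ` {p \<in> chart_dom c. H p \<in> chart_dom d}"
  have at: "local_rep c H d (chart_map c p) = chart_map d (H p)"
    using charts p by (simp add: local_rep_def)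
  have "(local_rep d F e \<circ> local_rep c H d has_derivative
      tangent_map d F e (H p) \<circ> tangent_map c H d p) (at (chart_map c p))"
    using local_rep_has_derivative[OF H charts(1,2) p(1,2)]
      local_rep_has_derivative[OF F charts(2,3) p(2,3)]
    by (intro diff_chain_at) (simp_all add: at)
  moreover have "open ?S"
    using H charts by (intro open_local_rep_domain) (auto simp: smooth_map_def)
  moreover have "chart_map c p \<in> ?S" using p by auto
  moreover have "(local_rep d F e \<circ> local_rep c H d) x = local_rep c (F \<circ> H) e x" if "x \<in> ?S" for x
    using that charts by (auto simp: local_rep_def)
  ultimately have "(local_rep c (F \<circ> H) e has_derivative
      tangent_map d F e (H p) \<circ> tangent_map c H d p) (at (chart_map c p))"
    by (rule has_derivative_transform_within_open)
  from fun_cong[OF frechet_derivative_at[OF this], of v] show ?thesis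
    by (simp only: comp_apply)
qed

lemma tangent_map_id:
  assumes "c \<in> \<A>" "p \<in> chart_dom c"
  shows "tangent_map c id c p v = v"
proof -
  have "(local_rep c id c has_derivative (\<lambda>v. v)) (at (chart_map c p))"
    by (rule has_derivative_transform_within_open[OF has_derivative_ident open_chart_range[OF assms(1)]])
      (use assms in \<open>auto simp: local_rep_def\<close>)
  from fun_cong[OF frechet_derivative_at[OF this], of v] show ?thesis by simp
qed

lemma lift_in_tangent_space:
  assumes "c \<in> \<A>" "p \<in> chart_dom c"
  shows "lift c p v \<in> tangent_space \<A> p"
proof -
  have "lift c p v e = tangent_map d id e p (lift c p v d)"
    if "d \<in> charts_at \<A> p" "e \<in> charts_at \<A> p" for d e
    using that assms tangent_map_compose[OF smooth_map_id smooth_map_id, of c d e p v]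
    by (simp add: lift_vector_def charts_at_def)
  moreover have "lift c p v d = 0" if "d \<notin> charts_at \<A> p" for d
    using that by (simp add: lift_vector_def)
  ultimately show ?thesis
    unfolding tangent_space_def by blast
qed

lemma lift_at_chart: "c \<in> \<A> \<Longrightarrow> p \<in> chart_dom c \<Longrightarrow> lift c p v c = v"
  by (simp add: lift_vector_def charts_at_def tangent_map_id)

lemma lift_tangent:
  assumes "c \<in> \<A>" "p \<in> chart_dom c" "\<xi> \<in> tangent_space \<A> p"
  shows "lift c p (\<xi> c) = \<xi>"
proof
  fix d
  have c: "c \<in> charts_at \<A> p" using assms by (simp add: charts_at_def)
  show "lift c p (\<xi> c) d = \<xi> d"
  proof (cases "d \<in> charts_at \<A> p")
    case True
    then have "\<xi> d = tangent_map c id d p (\<xi> c)"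
      using assms(3) c unfolding tangent_space_def by blast
    with True show ?thesis by (simp add: lift_vector_def)
  next
    case False
    then have "\<xi> d = 0" using assms(3) unfolding tangent_space_def by blast
    with False show ?thesis by (simp add: lift_vector_def)
  qed
qed

lemma lift_linear:
  assumes "c \<in> \<A>" "p \<in> chart_dom c"
  shows "lift c p (a *\<^sub>R u + b *\<^sub>R v) = (\<lambda>d. a *\<^sub>R lift c p u d + b *\<^sub>R lift c p v d)"
proof
  fix d
  show "lift c p (a *\<^sub>R u + b *\<^sub>R v) d = a *\<^sub>R lift c p u d + b *\<^sub>R lift c p v d"
  proof (cases "d \<in> charts_at \<A> p")
    case True
    then have "linear (tangent_map c id d p)"
      using has_derivative_linear[OF local_rep_has_derivative[OF smooth_map_id, of c d p]] assms
      by (simp add: charts_at_def)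
    with True show ?thesis
      by (simp add: lift_vector_def linear_add linear_cmul)
  qed (simp add: lift_vector_def)
qed

text \<open>The differential is computed in an arbitrary chart \<open>b\<close> at \<open>p\<close>. Inserting the transition maps from \<open>c\<close> to
  \<open>b\<close> and from \<open>d\<close> to the chart of evaluation reduces it to the representation of \<open>F\<close> in the charts
  \<open>c\<close> and \<open>d\<close>.\<close>

lemma differential_lift:
  assumes F: "smooth_map X \<A> F"
    and c: "c \<in> \<A>" "p \<in> chart_dom c" and d: "d \<in> \<A>" "F p \<in> chart_dom d"
  shows "differential \<A> F p (lift c p v) = lift d (F p) (tangent_map c F d p v)"
proof
  fix e
  \<comment> \<open>the chart in which \<open>differential\<close> is computed\<close>
  define b where "b = (SOME b. b \<in> charts_at \<A> p)"
  have "b \<in> charts_at \<A> p"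
    unfolding b_def using c someI[of "\<lambda>b. b \<in> charts_at \<A> p" c] by (simp add: charts_at_def)
  then have b: "b \<in> \<A>" "p \<in> chart_dom b" by (auto simp: charts_at_def)
  show "differential \<A> F p (lift c p v) e = lift d (F p) (tangent_map c F d p v) e"
  proof (cases "e \<in> charts_at \<A> (F p)")
    case True
    then have e: "e \<in> \<A>" "F p \<in> chart_dom e" by (auto simp: charts_at_def)
    have "differential \<A> F p (lift c p v) e = tangent_map b F e p (lift c p v b)"
      using True by (simp add: differential_def b_def[symmetric])
    also have "\<dots> = tangent_map b F e p (tangent_map c id b p v)"
      using b by (simp add: lift_vector_def charts_at_def)
    also have "\<dots> = tangent_map c F e p v"
      using tangent_map_compose[OF F smooth_map_id c(1) b(1) e(1), of p v] b c e by simp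
    also have "\<dots> = tangent_map d id e (F p) (tangent_map c F d p v)"
      using tangent_map_compose[OF smooth_map_id F c(1) d(1) e(1) c(2) d(2), of v] e by simp
    also have "\<dots> = lift d (F p) (tangent_map c F d p v) e"
      using True by (simp add: lift_vector_def)
    finally show ?thesis .
  qed (simp add: differential_def lift_vector_def Let_def)
qed

end

locale riemannian_manifold = manifold X \<A>
  for X :: "'a topology" and \<A> :: "('a, real ^ 'n) chart set" +
  fixes g :: "('a, real ^ 'n) metric" and \<omega> :: "('a, 'n) top_form"
  assumes metric: "riemannian_metric X \<A> g"
    and volume_form: "riemannian_volume_form X \<A> g \<omega>"
begin

definition volume_density :: "('a, real ^ 'n) chart \<Rightarrow> 'a \<Rightarrow> real" where
  "volume_density c p = \<bar>\<omega> p (coord_vector \<A> c p)\<bar>"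

lemma scalar_product_chart:
  assumes "c \<in> \<A>" "p \<in> chart_dom c"
  shows "scalar_product (\<lambda>u v. g p (lift c p u) (lift c p v))"
proof -
  have p: "p \<in> topspace X" using assms chart_dom_subset by blast
  note tan = lift_in_tangent_space[OF assms]
  have sym: "g p (lift c p u) (lift c p v) = g p (lift c p v) (lift c p u)" for u v
    using metric p tan unfolding riemannian_metric_def by blast
  have lin: "g p (lift c p (a *\<^sub>R u + b *\<^sub>R v)) (lift c p w)
      = a * g p (lift c p u) (lift c p w) + b * g p (lift c p v) (lift c p w)" for a b u v w
    unfolding lift_linear[OF assms] using metric p tan unfolding riemannian_metric_def by blast
  have left: "linear (\<lambda>u. g p (lift c p u) (lift c p w))" for w
    using lin[of 1 _ 1] lin[of _ _ 0] by (intro linearI) simp_all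
  have right: "linear (\<lambda>v. g p (lift c p w) (lift c p v))" for w
    using left[of w] by (simp only: sym[of w])
  show ?thesis
  proof
    show "bilinear (\<lambda>u v. g p (lift c p u) (lift c p v))"
      using left right by (simp add: bilinear_def)
    show "g p (lift c p u) (lift c p v) = g p (lift c p v) (lift c p u)" for u v
      by (rule sym)
    fix u :: "real ^ 'n" assume "u \<noteq> 0"
    then have "lift c p u \<noteq> (\<lambda>c. 0)"
      using lift_at_chart[OF assms, of u] by auto
    then show "0 < g p (lift c p u) (lift c p u)"
      using metric p tan unfolding riemannian_metric_def by blast
  qed
qed

lemma alternating_form_chart:
  assumes "c \<in> \<A>" "p \<in> chart_dom c"
  shows "alternating_form (\<lambda>v. \<omega> p (\<lambda>i. lift c p (v i)))"
proof
  have p: "p \<in> topspace X" using assms chart_dom_subset by blast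
  note tan = lift_in_tangent_space[OF assms]
  have form: "top_form X \<A> \<omega>"
    using volume_form by (simp add: riemannian_volume_form_def)
  fix v :: "'n \<Rightarrow> real ^ 'n" and i
  let ?\<xi> = "\<lambda>j. lift c p (v j)"
  have "\<forall>j. ?\<xi> j \<in> tangent_space \<A> p" using tan by blast
  with form p have at_v:
    "(\<forall>i. \<forall>\<eta>\<in>tangent_space \<A> p. \<forall>\<zeta>\<in>tangent_space \<A> p. \<forall>a b.
        \<omega> p (?\<xi>(i := (\<lambda>c. a *\<^sub>R \<eta> c + b *\<^sub>R \<zeta> c)))
          = a * \<omega> p (?\<xi>(i := \<eta>)) + b * \<omega> p (?\<xi>(i := \<zeta>))) \<and>
     (\<forall>i j. i \<noteq> j \<and> ?\<xi> i = ?\<xi> j \<longrightarrow> \<omega> p ?\<xi> = 0)"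
    unfolding top_form_def by meson
  have upd: "(\<lambda>j. lift c p ((v(i := z)) j)) = ?\<xi>(i := lift c p z)" for z
    by auto
  show "\<omega> p (\<lambda>j. lift c p ((v(i := a *\<^sub>R x + b *\<^sub>R y)) j))
      = a * \<omega> p (\<lambda>j. lift c p ((v(i := x)) j)) + b * \<omega> p (\<lambda>j. lift c p ((v(i := y)) j))" for x y a b
    unfolding upd lift_linear[OF assms] by (rule at_v[THEN conjunct1, rule_format, OF tan tan])
  show "\<omega> p ?\<xi> = 0" if "i \<noteq> j" "v i = v j" for j
  proof -
    have "?\<xi> i = ?\<xi> j" using that by simp
    then show ?thesis using at_v that(1) by blast
  qed
qed

text \<open>In the coordinates of \<open>c\<close>, the metric at \<open>p\<close> is a scalar product and the volume form an alternating
  form that is \<open>1\<close> or \<open>-1\<close> on orthonormal bases.\<close>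

lemma volume_density_eq_sqrt_det_gram:
  assumes "c \<in> \<A>" "p \<in> chart_dom c"
  shows "volume_density c p = sqrt (det (gram_matrix \<A> g c p))"
proof -
  interpret scalar_product "\<lambda>u v. g p (lift c p u) (lift c p v)"
    using assms by (rule scalar_product_chart)
  have "\<bar>\<omega> p (\<lambda>i. lift c p (axis i 1))\<bar>
      = sqrt (det (\<chi> i j. g p (lift c p (axis i 1)) (lift c p (axis j 1))))"
  proof (rule alternating_form_sqrt_Gram[OF alternating_form_chart[OF assms]])
    fix e :: "'n \<Rightarrow> real ^ 'n"
    assume "\<And>i j. g p (lift c p (e i)) (lift c p (e j)) = (if i = j then 1 else 0)"
    then have "orthonormal_frame \<A> g p (\<lambda>i. lift c p (e i))"
      using lift_in_tangent_space[OF assms] by (simp add: orthonormal_frame_def)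
    moreover have "p \<in> topspace X" using assms chart_dom_subset by blast
    ultimately show "\<bar>\<omega> p (\<lambda>i. lift c p (e i))\<bar> = 1"
      using volume_form by (simp add: riemannian_volume_form_def)
  qed
  then show ?thesis
    by (simp add: volume_density_def gram_matrix_def coord_vector_def[abs_def])
qed

lemma continuous_on_volume_density:
  assumes "c \<in> \<A>"
  shows "continuous_on (chart_range c) (\<lambda>x. volume_density c (chart_inv c x))"
proof -
  have "smooth_on (chart_range c) (\<lambda>x. \<omega> (chart_inv c x) (coord_vector \<A> c (chart_inv c x)))"
    using volume_form assms by (simp add: riemannian_volume_form_def top_form_def)
  then show ?thesis
    unfolding volume_density_def by (intro continuous_on_rabs smooth_on_imp_continuous_on)
qed

text \<open>The differential maps the coordinate vectors of \<open>c\<close> at \<open>p\<close> to combinations of those of \<open>d\<close> at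
  \<open>F p\<close>, with the Jacobian matrix as coefficients; an alternating form multiplies by its
  determinant.\<close>

lemma det_tangent_map_volume_density:
  assumes F: "smooth_map X \<A> F"
    and pullback: "\<And>\<xi>. (\<And>i. \<xi> i \<in> tangent_space \<A> p) \<Longrightarrow> pullback_form \<A> F \<omega> p \<xi> = a * \<omega> p \<xi>"
    and c: "c \<in> \<A>" "p \<in> chart_dom c" and d: "d \<in> \<A>" "F p \<in> chart_dom d"
  shows "\<bar>det (matrix (tangent_map c F d p))\<bar> * volume_density d (F p) = \<bar>a\<bar> * volume_density c p"
proof -
  interpret alternating_form "\<lambda>v. \<omega> (F p) (\<lambda>i. lift d (F p) (v i))"
    using d by (rule alternating_form_chart)
  let ?T = "tangent_map c F d p"
  have "a * \<omega> p (coord_vector \<A> c p) = pullback_form \<A> F \<omega> p (coord_vector \<A> c p)"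
    using lift_in_tangent_space[OF c] by (intro pullback[symmetric]) (simp add: coord_vector_def)
  also have "\<dots> = \<omega> (F p) (\<lambda>i. lift d (F p) (?T (axis i 1)))"
    by (simp add: pullback_form_def coord_vector_def differential_lift[OF F c d])
  also have "\<dots> = det (\<chi> i. ?T (axis i 1)) * \<omega> (F p) (coord_vector \<A> d (F p))"
    using eq_det[of "\<lambda>i. ?T (axis i 1)"] by (simp add: coord_vector_def[abs_def])
  also have "(\<chi> i. ?T (axis i 1)) = transpose (matrix ?T)"
    by (simp add: matrix_def transpose_def vec_eq_iff)
  finally show ?thesis
    by (simp add: volume_density_def flip: abs_mult)
qed

end

section \<open>The Riemannian volume of images\<close>

text \<open>Tonelli's theorem for the counting measure.\<close>

lemma ennreal_suminf_swap: "(\<Sum>i. \<Sum>j. f i j) = (\<Sum>j. \<Sum>i. (f i j :: ennreal))"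
  using nn_integral_suminf[of f "count_space UNIV"] by (simp add: nn_integral_count_space_nat)

abbreviation borel_algebra :: "'a topology \<Rightarrow> 'a measure" where
  "borel_algebra X \<equiv> sigma (topspace X) {U. openin X U}"

lemma openin_subset_Pow: "{U. openin X U} \<subseteq> Pow (topspace X)"
  by (auto dest: openin_subset)

lemma sets_borel_algebra: "sets (borel_algebra X) = sigma_sets (topspace X) {U. openin X U}"
  and space_borel_algebra: "space (borel_algebra X) = topspace X"
  by (simp_all only: sets_measure_of space_measure_of openin_subset_Pow)

lemma openin_in_borel_algebra: "openin X U \<Longrightarrow> U \<in> sets (borel_algebra X)"
  by (simp add: sets_borel_algebra sigma_sets.Basic)

lemma closedin_in_borel_algebra:
  assumes "closedin X C"
  shows "C \<in> sets (borel_algebra X)"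
proof -
  have "topspace X - C \<in> sets (borel_algebra X)"
    using assms by (intro openin_in_borel_algebra) blast
  from sets.compl_sets[OF this] have "topspace X - (topspace X - C) \<in> sets (borel_algebra X)"
    by (simp add: space_borel_algebra)
  moreover have "topspace X - (topspace X - C) = C"
    using closedin_subset[OF assms] by blast
  ultimately show ?thesis by simp
qed

lemma in_borel_algebra_subset: "E \<in> sets (borel_algebra X) \<Longrightarrow> E \<subseteq> topspace X"
  using sets.sets_into_space[of E "borel_algebra X"] by (simp add: space_borel_algebra)

lemma borel_algebra_preimage:
  assumes "continuous_map X Y F" "E \<in> sets (borel_algebra Y)"
  shows "{p \<in> topspace X. F p \<in> E} \<in> sets (borel_algebra X)"
proof -
  have "F \<in> measurable (borel_algebra X) (borel_algebra Y)"
  proof (rule measurable_measure_of)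
    show "F \<in> space (borel_algebra X) \<rightarrow> topspace Y"
      using assms(1) by (auto simp: space_borel_algebra dest: continuous_map_funspace)
    fix U assume "U \<in> {U. openin Y U}"
    then have "openin X {p \<in> topspace X. F p \<in> U}"
      using assms(1) by (auto intro: openin_continuous_map_preimage)
    moreover have "F -` U \<inter> space (borel_algebra X) = {p \<in> topspace X. F p \<in> U}"
      by (auto simp: space_borel_algebra)
    ultimately show "F -` U \<inter> space (borel_algebra X) \<in> sets (borel_algebra X)"
      by (simp only: openin_in_borel_algebra)
  qed (rule openin_subset_Pow)
  from measurable_sets[OF this assms(2)] have "F -` E \<inter> topspace X \<in> sets (borel_algebra X)"
    by (simp add: space_borel_algebra)
  moreover have "F -` E \<inter> topspace X = {p \<in> topspace X. F p \<in> E}" by blast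
  ultimately show ?thesis by (simp only:)
qed

text \<open>This brings Borel sets of a chart domain, carried over by the inverse chart, to Borel sets of \<open>\<real>\<^sup>n\<close>.\<close>

lemma borel_algebra_euclidean_subspace:
  assumes "open U" "E \<in> sets (borel_algebra (top_of_set U))"
  shows "E \<in> sets borel"
proof -
  have "E \<in> sigma_sets U {W. openin (top_of_set U) W}"
    using assms(2) sets_borel_algebra[of "top_of_set U"] by simp
  then show ?thesis
  proof induction
    case (Basic W)
    then have "open W" by (simp add: openin_open_trans assms(1))
    then show ?case by (rule borel_open)
  next
    case (Compl W)
    then show ?case using assms(1) by auto
  qed auto
qed

context manifold
begin

lemma chart_dom_borel: "c \<in> \<A> \<Longrightarrow> chart_dom c \<in> sets (borel_algebra X)"
  by (simp only: openin_in_borel_algebra openin_chart_dom)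

lemma chart_image_borel:
  assumes "c \<in> \<A>" "E \<in> sets (borel_algebra X)" "E \<subseteq> chart_dom c"
  shows "chart_map c ` E \<in> sets borel"
proof -
  have "chart_map c ` E = {x \<in> topspace (top_of_set (chart_range c)). chart_inv c x \<in> E}"
  proof safe
    fix p assume p: "p \<in> E"
    then show "chart_map c p \<in> topspace (top_of_set (chart_range c))" "chart_inv c (chart_map c p) \<in> E"
      using assms(1,3) by auto
  next
    fix x assume "x \<in> topspace (top_of_set (chart_range c))" "chart_inv c x \<in> E"
    then show "x \<in> chart_map c ` E"
      by (metis chart_map_chart_inv imageI topspace_euclidean_subtopology)
  qed
  moreover have "{x \<in> topspace (top_of_set (chart_range c)). chart_inv c x \<in> E}
      \<in> sets (borel_algebra (top_of_set (chart_range c)))"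
    using continuous_chart_inv[OF assms(1)] assms(2) by (rule borel_algebra_preimage)
  ultimately show ?thesis
    using borel_algebra_euclidean_subspace[OF open_chart_range[OF assms(1)]] by (simp only:)
qed

lemma chart_cover_exists:
  assumes "topspace X \<noteq> {}"
  shows "\<exists>c. chart_cover X \<A> c"
proof -
  have cover: "(\<Union>c\<in>\<A>. chart_dom c) = topspace X" and "second_countable X"
    using smooth_manifold by (simp_all add: smooth_manifold_def)
  then have "Lindelof_space X" by (intro second_countable_imp_Lindelof_space)
  then obtain \<V> where \<V>: "countable \<V>" "\<V> \<subseteq> chart_dom ` \<A>" "topspace X \<subseteq> \<Union>\<V>"
    unfolding Lindelof_space_alt using openin_chart_dom cover by (metis (no_types, lifting) imageE order_refl)
  then obtain \<B> where \<B>: "countable \<B>" "\<B> \<subseteq> \<A>" "\<V> = chart_dom ` \<B>"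
    by (meson countable_subset_image)
  with \<V> assms have "\<B> \<noteq> {}" by auto
  with \<B>(1) have "range (from_nat_into \<B>) = \<B>" by simp
  moreover from this have "(\<Union>n. chart_dom (from_nat_into \<B> n)) = \<Union>\<V>"
    using \<B>(3) by (metis image_image)
  moreover have "\<Union>\<V> = topspace X"
    using \<V> cover by blast
  ultimately show ?thesis
    using \<B>(2) by (intro exI[of _ "from_nat_into \<B>"]) (simp only: chart_cover_def)
qed

end

context riemannian_manifold
begin

abbreviation (input) vol :: "('a, real ^ 'n) chart \<Rightarrow> 'a set \<Rightarrow> ennreal" where
  "vol \<equiv> chart_volume \<A> g"

text \<open>Extended by \<open>0\<close> outside the range of the chart, the density is Borel measurable on all of \<open>\<real>\<^sup>n\<close>.\<close>

definition coord_density :: "('a, real ^ 'n) chart \<Rightarrow> real ^ 'n \<Rightarrow> real" where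
  "coord_density c x = indicator (chart_range c) x *\<^sub>R volume_density c (chart_inv c x)"

lemma coord_density_nonneg: "0 \<le> coord_density c x"
  by (simp add: coord_density_def volume_density_def)

lemma coord_density_chart_map: "c \<in> \<A> \<Longrightarrow> p \<in> chart_dom c \<Longrightarrow> coord_density c (chart_map c p) = volume_density c p"
  by (simp add: coord_density_def)

lemma borel_measurable_coord_density: "c \<in> \<A> \<Longrightarrow> coord_density c \<in> borel_measurable borel"
  unfolding coord_density_def[abs_def] using open_chart_range continuous_on_volume_density
  by (intro borel_measurable_continuous_on_indicator) auto

lemma chart_volume_eq:
  assumes "c \<in> \<A>" "E \<subseteq> chart_dom c"
  shows "vol c E = (\<integral>\<^sup>+x\<in>chart_map c ` E. ennreal (coord_density c x) \<partial>lborel)"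
  unfolding chart_volume_def
proof (intro nn_integral_cong)
  fix x
  show "ennreal (sqrt (det (gram_matrix \<A> g c (chart_inv c x)))) * indicator (chart_map c ` E) x
      = ennreal (coord_density c x) * indicator (chart_map c ` E) x"
    using assms by (auto simp: indicator_def coord_density_chart_map volume_density_eq_sqrt_det_gram
        dest!: subsetD)
qed

lemma chart_volume_eq_emeasure:
  assumes "c \<in> \<A>" "E \<in> sets (borel_algebra X)" "E \<subseteq> chart_dom c"
  shows "vol c E = emeasure (density lborel (\<lambda>x. ennreal (coord_density c x))) (chart_map c ` E)"
  using assms borel_measurable_coord_density[OF assms(1)] chart_image_borel[OF assms]
  by (simp add: chart_volume_eq emeasure_density)

lemma chart_volume_UN:
  fixes E :: "nat \<Rightarrow> 'a set"
  assumes c: "c \<in> \<A>" and E: "\<And>i. E i \<in> sets (borel_algebra X)" "\<And>i. E i \<subseteq> chart_dom c"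
    and disj: "disjoint_family E"
  shows "vol c (\<Union>i. E i) = (\<Sum>i. vol c (E i))"
proof -
  let ?M = "density lborel (\<lambda>x. ennreal (coord_density c x))"
  have "disjoint_family (\<lambda>i. chart_map c ` E i)"
    using disj inj_on_chart_map[OF c] E(2)
    unfolding disjoint_family_on_def by (metis image_empty inj_on_image_Int)
  then have "(\<Sum>i. emeasure ?M (chart_map c ` E i)) = emeasure ?M (\<Union>i. chart_map c ` E i)"
    using chart_image_borel[OF c E] by (intro suminf_emeasure) auto
  moreover have "(\<Union>i. E i) \<in> sets (borel_algebra X)" "(\<Union>i. E i) \<subseteq> chart_dom c"
    using E by blast+
  ultimately show ?thesis
    using chart_volume_eq_emeasure[OF c] E by (simp only: image_UN)
qed

text \<open>The change of variables formula for the coordinate representation of \<open>F\<close>; the integrands are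
  compared pointwise by \<open>det_tangent_map_volume_density\<close>.\<close>

lemma chart_volume_image_le:
  assumes F: "smooth_map X \<A> F" "inj_on F E"
    and c: "c \<in> \<A>" "E \<subseteq> chart_dom c" "E \<in> sets (borel_algebra X)"
    and d: "d \<in> \<A>" "F ` E \<subseteq> chart_dom d" "F ` E \<in> sets (borel_algebra X)"
    and pullback: "\<And>p \<xi>. p \<in> E \<Longrightarrow> (\<And>i. \<xi> i \<in> tangent_space \<A> p) \<Longrightarrow>
      pullback_form \<A> F \<omega> p \<xi> = A p * \<omega> p \<xi>"
    and A: "\<And>p. p \<in> E \<Longrightarrow> \<bar>A p\<bar> \<le> a" and "0 \<le> a"
  shows "vol d (F ` E) \<le> ennreal a * vol c E"
proof -
  let ?S = "chart_map c ` E" and ?G = "local_rep c F d"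
  have rep: "?G (chart_map c p) = chart_map d (F p)" if "p \<in> E" for p
    using that c by (auto simp: local_rep_def)
  then have image: "?G ` ?S = chart_map d ` F ` E"
    by (simp add: image_image cong: image_cong)
  have "(\<integral>\<^sup>+x\<in>?G ` ?S. ennreal (coord_density d x) \<partial>lborel)
      \<le> (\<integral>\<^sup>+x\<in>?S. ennreal a * ennreal (coord_density c x) \<partial>lborel)"
  proof (rule nn_integral_image_le[where g' = "\<lambda>x. frechet_derivative ?G (at x)"])
    show "?S \<in> sets borel" using c(1,3,2) by (rule chart_image_borel)
    show "?G ` ?S \<in> sets borel" unfolding image using d(1,3,2) by (rule chart_image_borel)
    show "(?G has_derivative frechet_derivative ?G (at x)) (at x within ?S)" if x: "x \<in> ?S" for x
    proof (rule has_derivative_at_withinI)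
      from x obtain p where p: "p \<in> E" "x = chart_map c p" by blast
      then have "p \<in> chart_dom c" "F p \<in> chart_dom d" using c d by auto
      then show "(?G has_derivative frechet_derivative ?G (at x)) (at x)"
        unfolding p(2) by (rule local_rep_has_derivative[OF F(1) c(1) d(1)])
    qed
    show "inj_on ?G ?S"
    proof (rule inj_onI)
      fix x y assume "x \<in> ?S" "y \<in> ?S" and eq: "?G x = ?G y"
      then obtain p q where pq: "p \<in> E" "q \<in> E" "x = chart_map c p" "y = chart_map c q" by blast
      then have "chart_map d (F p) = chart_map d (F q)" using eq rep by simp
      moreover have "F p \<in> chart_dom d" "F q \<in> chart_dom d" using pq d(2) by auto
      ultimately have "F p = F q"
        using inj_on_chart_map[OF d(1)] by (auto dest: inj_onD)
      then show "x = y" using pq F(2) by (auto dest: inj_onD)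
    qed
    show "coord_density d \<in> borel_measurable borel" "\<And>x. 0 \<le> coord_density d x"
      using d(1) by (simp_all add: borel_measurable_coord_density coord_density_nonneg)
    show "(\<lambda>x. ennreal a * ennreal (coord_density c x)) \<in> borel_measurable borel"
      using borel_measurable_coord_density[OF c(1)] by measurable
    fix x assume "x \<in> ?S"
    then obtain p where p: "p \<in> E" "x = chart_map c p" by blast
    then have dom: "p \<in> chart_dom c" "F p \<in> chart_dom d" using c d by auto
    have "\<bar>det (matrix (tangent_map c F d p))\<bar> * volume_density d (F p) = \<bar>A p\<bar> * volume_density c p"
      using F(1) pullback[OF p(1)] c(1) dom(1) d(1) dom(2) by (rule det_tangent_map_volume_density)
    also have "\<dots> \<le> a * volume_density c p"
      using A[OF p(1)] by (intro mult_right_mono) (simp_all add: volume_density_def)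
    finally show "ennreal (\<bar>det (matrix (frechet_derivative ?G (at x)))\<bar> * coord_density d (?G x))
        \<le> ennreal a * ennreal (coord_density c x)"
      using p dom c(1) d(1) \<open>0 \<le> a\<close> rep[OF p(1)]
      by (simp add: coord_density_chart_map ennreal_leI flip: ennreal_mult')
  qed
  also have "\<dots> = ennreal a * (\<integral>\<^sup>+x\<in>?S. ennreal (coord_density c x) \<partial>lborel)"
    using borel_measurable_coord_density[OF c(1)] chart_image_borel[OF c(1,3,2)]
    by (subst nn_integral_cmult[symmetric]) (auto simp: mult.assoc)
  finally show ?thesis
    using c d by (simp add: chart_volume_eq image)
qed

lemma sets_riemannian_volume: "sets (riemannian_volume X \<A> g) = sets (borel_algebra X)"
  unfolding riemannian_volume_def Let_def by (simp only: sets_measure_of openin_subset_Pow)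

text \<open>A countable Borel partition of the manifold into sets contained in charts along which the
  Riemannian volume is computed.\<close>

definition volume_pieces :: "(nat \<Rightarrow> ('a, real ^ 'n) chart) \<Rightarrow> (nat \<Rightarrow> 'a set) \<Rightarrow> bool" where
  "volume_pieces c D \<longleftrightarrow>
    (\<forall>n. c n \<in> \<A>) \<and> (\<forall>n. D n \<in> sets (borel_algebra X)) \<and> (\<forall>n. D n \<subseteq> chart_dom (c n)) \<and>
    disjoint_family D \<and> (\<Union>n. D n) = topspace X \<and>
    (\<forall>E\<in>sets (borel_algebra X).
      emeasure (riemannian_volume X \<A> g) E = (\<Sum>n. vol (c n) (E \<inter> D n)))"

text \<open>The pieces are those that define the Riemannian volume. Each \<open>chart_volume\<close> is countably additive
  on its piece, and interchanging the two sums makes their total a measure.\<close>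

lemma volume_pieces_exist:
  assumes "topspace X \<noteq> {}"
  shows "\<exists>c D. volume_pieces c D"
  unfolding volume_pieces_def
proof (intro exI conjI allI ballI)
  define c where "c = (SOME c. chart_cover X \<A> c)"
  have cover: "chart_cover X \<A> c"
    unfolding c_def using chart_cover_exists[OF assms] by (rule someI_ex)
  let ?D = "disjointed (\<lambda>m. chart_dom (c m))"
  let ?V = "\<lambda>E. \<Sum>n. vol (c n) (E \<inter> ?D n)"
  show c: "c n \<in> \<A>" for n using cover by (auto simp: chart_cover_def)
  show D: "?D n \<in> sets (borel_algebra X)" for n
    using sets.range_disjointed_sets[of "\<lambda>m. chart_dom (c m)" "borel_algebra X"] chart_dom_borel[OF c]
    by blast
  show D_sub: "?D n \<subseteq> chart_dom (c n)" for n by (rule disjointed_subset)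
  show "disjoint_family ?D" by (rule disjoint_family_disjointed)
  show "(\<Union>n. ?D n) = topspace X"
    using cover by (simp add: chart_cover_def UN_disjointed_eq)
  have eq: "riemannian_volume X \<A> g = measure_of (topspace X) {U. openin X U} ?V"
    by (simp add: riemannian_volume_def c_def Let_def)
  have pos: "positive (sets (riemannian_volume X \<A> g)) ?V"
    by (simp add: positive_def chart_volume_def)
  have add: "countably_additive (sets (riemannian_volume X \<A> g)) ?V"
  proof (rule countably_additiveI)
    fix E :: "nat \<Rightarrow> 'a set"
    assume "range E \<subseteq> sets (riemannian_volume X \<A> g)" and disj: "disjoint_family E"
    then have E: "E i \<in> sets (borel_algebra X)" for i
      by (auto simp only: sets_riemannian_volume)
    have "vol (c n) (\<Union>i. E i \<inter> ?D n) = (\<Sum>i. vol (c n) (E i \<inter> ?D n))" for n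
    proof (rule chart_volume_UN[OF c])
      show "disjoint_family (\<lambda>i. E i \<inter> ?D n)"
        using disj by (auto simp: disjoint_family_on_def)
    qed (use E D D_sub in blast)+
    then show "(\<Sum>i. ?V (E i)) = ?V (\<Union>i. E i)"
      by (subst ennreal_suminf_swap) (simp add: Int_UN_distrib2)
  qed
  show "emeasure (riemannian_volume X \<A> g) E = ?V E" if "E \<in> sets (borel_algebra X)" for E
    by (rule emeasure_measure_of[OF eq openin_subset_Pow pos add])
      (simp only: sets_riemannian_volume that)
qed

lemma volume_piecesD:
  assumes "volume_pieces c D"
  shows "c n \<in> \<A>" "D n \<in> sets (borel_algebra X)" "D n \<subseteq> chart_dom (c n)"
    and "disjoint_family D" "(\<Union>n. D n) = topspace X"
    and "E \<in> sets (borel_algebra X) \<Longrightarrow>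
      emeasure (riemannian_volume X \<A> g) E = (\<Sum>n. vol (c n) (E \<inter> D n))"
  using assms unfolding volume_pieces_def by blast+

text \<open>The identity pulls the volume form back to itself, so the inequality \<open>chart_volume_image_le\<close> applies to it with
  \<open>a = 1\<close>, from the chart \<open>d\<close> to the chart of each piece.\<close>

lemma riemannian_volume_le_chart_volume:
  assumes d: "d \<in> \<A>" "E \<subseteq> chart_dom d" "E \<in> sets (borel_algebra X)"
  shows "emeasure (riemannian_volume X \<A> g) E \<le> vol d E"
proof (cases "topspace X = {}")
  case True
  then have "E = {}" using in_borel_algebra_subset[OF d(3)] by simp
  then show ?thesis by simp
next
  case False
  obtain c D where pieces: "volume_pieces c D"
    using volume_pieces_exist[OF False] by blast
  note c = volume_piecesD(1)[OF pieces] and D = volume_piecesD(2)[OF pieces]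
    and D_sub = volume_piecesD(3)[OF pieces] and D_disj = volume_piecesD(4)[OF pieces]
    and UN_D = volume_piecesD(5)[OF pieces] and V = volume_piecesD(6)[OF pieces]
  have id: "pullback_form \<A> id \<omega> p \<xi> = \<omega> p \<xi>"
    if p: "p \<in> chart_dom d" and \<xi>: "\<And>i. \<xi> i \<in> tangent_space \<A> p" for p \<xi>
  proof -
    have "differential \<A> id p (\<xi> i) = \<xi> i" for i
      using differential_lift[OF smooth_map_id d(1) p d(1), of "\<xi> i d"] p
      by (simp add: lift_tangent[OF d(1) p \<xi>] tangent_map_id[OF d(1) p])
    then show ?thesis by (simp add: pullback_form_def)
  qed
  have "emeasure (riemannian_volume X \<A> g) E = (\<Sum>n. vol (c n) (id ` (E \<inter> D n)))"
    using V d(3) by simp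
  also have "\<dots> \<le> (\<Sum>n. ennreal 1 * vol d (E \<inter> D n))"
  proof (intro suminf_le)
    fix n
    have "E \<inter> D n \<in> sets (borel_algebra X)" using d(3) D by blast
    then show "vol (c n) (id ` (E \<inter> D n)) \<le> ennreal 1 * vol d (E \<inter> D n)"
      using d c D_sub[of n] id
      by (intro chart_volume_image_le[OF smooth_map_id, where A = "\<lambda>_. 1"]) auto
  qed auto
  also have "\<dots> = vol d (\<Union>n. E \<inter> D n)"
  proof -
    have "disjoint_family (\<lambda>n. E \<inter> D n)"
      using D_disj unfolding disjoint_family_on_def by blast
    moreover have "E \<inter> D n \<in> sets (borel_algebra X)" "E \<inter> D n \<subseteq> chart_dom d" for n
      using d D by blast+
    ultimately show ?thesis
      using chart_volume_UN[OF d(1), of "\<lambda>n. E \<inter> D n"] by simp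
  qed
  also have "(\<Union>n. E \<inter> D n) = E"
    using UN_D in_borel_algebra_subset[OF d(3)] by blast
  finally show ?thesis .
qed

text \<open>The set \<open>E\<close> is cut into the parts \<open>P n m\<close>, which lie in the piece \<open>D n\<close> and are mapped into the
  piece \<open>D m\<close>. The inequality holds for each of them in the charts of these two pieces. Summing over
  all parts yields the volume of \<open>E\<close> on one side and that of \<open>F ` E\<close> on the other.\<close>

lemma riemannian_volume_image_le:
  assumes F: "smooth_map X \<A> F" "inj_on F (topspace X)"
    and borel: "\<And>E. E \<in> sets (borel_algebra X) \<Longrightarrow> F ` E \<in> sets (borel_algebra X)"
    and pullback: "\<And>p \<xi>. p \<in> topspace X \<Longrightarrow> (\<And>i. \<xi> i \<in> tangent_space \<A> p) \<Longrightarrow>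
      pullback_form \<A> F \<omega> p \<xi> = A p * \<omega> p \<xi>"
    and A: "\<And>p. p \<in> topspace X \<Longrightarrow> \<bar>A p\<bar> \<le> a" and "0 \<le> a"
    and E: "E \<in> sets (borel_algebra X)"
  shows "emeasure (riemannian_volume X \<A> g) (F ` E) \<le> ennreal a * emeasure (riemannian_volume X \<A> g) E"
proof (cases "topspace X = {}")
  case True
  then have "E = {}" using in_borel_algebra_subset[OF E] by simp
  then show ?thesis by simp
next
  case False
  obtain c D where pieces: "volume_pieces c D"
    using volume_pieces_exist[OF False] by blast
  note c = volume_piecesD(1)[OF pieces] and D = volume_piecesD(2)[OF pieces]
    and D_sub = volume_piecesD(3)[OF pieces] and D_disj = volume_piecesD(4)[OF pieces]
    and UN_D = volume_piecesD(5)[OF pieces] and V = volume_piecesD(6)[OF pieces]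
  have E_sub: "E \<subseteq> topspace X" using E by (rule in_borel_algebra_subset)
  have F_sub: "F ` topspace X \<subseteq> topspace X"
    using F(1) by (auto simp: smooth_map_def dest: continuous_map_funspace)
  define P where "P n m = E \<inter> D n \<inter> {p \<in> topspace X. F p \<in> D m}" for n m
  have P: "P n m \<in> sets (borel_algebra X)" for n m
  proof -
    have "{p \<in> topspace X. F p \<in> D m} \<in> sets (borel_algebra X)"
      using F(1) D by (intro borel_algebra_preimage) (auto simp: smooth_map_def)
    then show ?thesis unfolding P_def using E D by blast
  qed
  have P_dom: "P n m \<subseteq> chart_dom (c n)" "F ` P n m \<subseteq> chart_dom (c m)" "P n m \<subseteq> topspace X" for n m
    using D_sub E_sub by (auto simp: P_def)
  have inj: "inj_on F (P n m)" for n m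
    using F(2) P_dom(3) by (rule inj_on_subset)
  have piece: "vol (c m) (F ` P n m) \<le> ennreal a * vol (c n) (P n m)" for n m
    using P_dom(3)[of n m] pullback A \<open>0 \<le> a\<close>
    by (intro chart_volume_image_le[OF F(1) inj c P_dom(1) P c P_dom(2) borel[OF P]]) blast+
  have split_image: "F ` E \<inter> D m = (\<Union>n. F ` P n m)" for m
    using UN_D E_sub by (fastforce simp: P_def)
  have disj_image: "disjoint_family (\<lambda>n. F ` P n m)" for m
    unfolding disjoint_family_on_def
  proof (intro ballI impI)
    fix i j :: nat assume "i \<noteq> j"
    then have "P i m \<inter> P j m = {}"
      using D_disj unfolding P_def disjoint_family_on_def by blast
    then show "F ` P i m \<inter> F ` P j m = {}"
      using inj_on_image_Int[OF F(2) P_dom(3) P_dom(3)] by (metis image_empty)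
  qed
  have split: "vol (c m) (F ` E \<inter> D m) = (\<Sum>n. vol (c m) (F ` P n m))" for m
    unfolding split_image by (rule chart_volume_UN[OF c borel[OF P] P_dom(2) disj_image])
  have merge_domain: "E \<inter> D n = (\<Union>m. P n m)" for n
  proof
    show "E \<inter> D n \<subseteq> (\<Union>m. P n m)"
    proof
      fix p assume p: "p \<in> E \<inter> D n"
      with E_sub F_sub have "F p \<in> (\<Union>m. D m)" unfolding UN_D by blast
      with p E_sub show "p \<in> (\<Union>m. P n m)" unfolding P_def by blast
    qed
  qed (auto simp: P_def)
  have disj_domain: "disjoint_family (\<lambda>m. P n m)" for n
    using D_disj unfolding P_def disjoint_family_on_def by blast
  have merge: "(\<Sum>m. vol (c n) (P n m)) = vol (c n) (E \<inter> D n)" for n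
    unfolding merge_domain by (rule chart_volume_UN[OF c P P_dom(1) disj_domain, symmetric])
  have "emeasure (riemannian_volume X \<A> g) (F ` E) = (\<Sum>m. \<Sum>n. vol (c m) (F ` P n m))"
    using V[OF borel[OF E]] split by simp
  also have "\<dots> \<le> (\<Sum>m. \<Sum>n. ennreal a * vol (c n) (P n m))"
    by (intro suminf_le piece) auto
  also have "\<dots> = ennreal a * (\<Sum>n. \<Sum>m. vol (c n) (P n m))"
    by (subst ennreal_suminf_swap) simp
  also have "(\<Sum>n. \<Sum>m. vol (c n) (P n m)) = emeasure (riemannian_volume X \<A> g) E"
    using V[OF E] merge by simp
  finally show ?thesis .
qed

end

section \<open>Backward orbits under a volume-contracting map\<close>

context riemannian_manifold
begin

text \<open>The density is continuous, hence bounded on a compact set.\<close>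

lemma chart_volume_compact_finite:
  assumes c: "c \<in> \<A>" and C: "compact C" "C \<subseteq> chart_range c"
  shows "vol c (chart_inv c ` C) < \<infinity>"
proof -
  have sub: "chart_inv c ` C \<subseteq> chart_dom c"
    using C(2) chart_inv_in_dom by blast
  have "chart_map c (chart_inv c x) = x" if "x \<in> C" for x
    using that C(2) chart_map_chart_inv by blast
  then have image: "chart_map c ` chart_inv c ` C = C"
    by (simp add: image_image)
  have "continuous_on C (\<lambda>x. volume_density c (chart_inv c x))"
    using continuous_on_volume_density[OF c] C(2) by (rule continuous_on_subset)
  then have "bounded ((\<lambda>x. volume_density c (chart_inv c x)) ` C)"
    using C(1) by (intro compact_imp_bounded compact_continuous_image)
  then obtain B where B: "\<And>x. x \<in> C \<Longrightarrow> \<bar>volume_density c (chart_inv c x)\<bar> \<le> B"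
    unfolding bounded_iff by auto
  have "vol c (chart_inv c ` C) = (\<integral>\<^sup>+x\<in>C. ennreal (coord_density c x) \<partial>lborel)"
    unfolding chart_volume_eq[OF c sub] image ..
  also have "\<dots> \<le> (\<integral>\<^sup>+x. ennreal B * indicator C x \<partial>lborel)"
  proof (rule nn_integral_mono)
    fix x
    have "coord_density c x \<le> B" if "x \<in> C"
      using B[OF that] that C(2) by (auto simp: coord_density_def)
    then show "ennreal (coord_density c x) * indicator C x \<le> ennreal B * indicator C x"
      by (auto simp: indicator_def intro: ennreal_leI)
  qed
  also have "\<dots> = ennreal B * emeasure lborel C"
    using C(1) by (intro nn_integral_cmult_indicator) (simp add: borel_compact)
  also have "\<dots> < \<infinity>"
    using emeasure_bounded_finite[OF compact_imp_bounded[OF C(1)]] by (simp add: ennreal_mult_less_top)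
  finally show ?thesis .
qed

lemma openin_chart_inv_image:
  assumes c: "c \<in> \<A>" and W: "open W" "W \<subseteq> chart_range c"
  shows "openin X (chart_inv c ` W)"
proof -
  have "continuous_map (subtopology X (chart_dom c)) (top_of_set (chart_range c)) (chart_map c)"
    using homeomorphic_chart_map[OF c] by (rule homeomorphic_imp_continuous_map)
  then have "openin (subtopology X (chart_dom c))
      {p \<in> topspace (subtopology X (chart_dom c)). chart_map c p \<in> W}"
    by (rule openin_continuous_map_preimage) (simp add: W openin_open_eq open_chart_range[OF c])
  moreover have "{p \<in> topspace (subtopology X (chart_dom c)). chart_map c p \<in> W} = chart_inv c ` W"
  proof safe
    fix p assume "p \<in> topspace (subtopology X (chart_dom c))" "chart_map c p \<in> W"
    then show "p \<in> chart_inv c ` W"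
      using c by (metis chart_inv_chart_map imageI IntD2 topspace_subtopology)
  next
    fix x assume "x \<in> W"
    then have x: "x \<in> chart_range c" using W(2) by blast
    show "chart_inv c x \<in> topspace (subtopology X (chart_dom c))"
      using chart_inv_in_dom[OF x] chart_dom_subset[OF c] by auto
    show "chart_map c (chart_inv c x) \<in> W"
      using \<open>x \<in> W\<close> by (simp add: chart_map_chart_inv[OF x])
  qed
  ultimately show ?thesis
    using openin_trans_full[OF _ openin_chart_dom[OF c]] by simp
qed

text \<open>The sets are the preimages of a compact exhaustion of each chart range, for countably many charts
  that cover the manifold. The preimages of the interiors are an open cover, so a compact set needs
  only finitely many of them; their volume is finite by comparison with the volume in their own
  chart.\<close>

lemma compact_finite_volume_cover:
  assumes "topspace X \<noteq> {}"
  shows "\<exists>L :: nat \<Rightarrow> 'a set. (\<forall>k. compactin X (L k)) \<and>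
    (\<forall>k. emeasure (riemannian_volume X \<A> g) (L k) < \<infinity>) \<and>
    (\<forall>K. compactin X K \<longrightarrow> (\<exists>I. finite I \<and> K \<subseteq> (\<Union>k\<in>I. L k)))"
proof -
  obtain c where cover: "chart_cover X \<A> c" using chart_cover_exists[OF assms] by blast
  then have c: "c m \<in> \<A>" for m by (auto simp: chart_cover_def)
  have "\<exists>C :: nat \<Rightarrow> (real ^ 'n) set. (\<forall>k. compact (C k)) \<and> (\<forall>k. C k \<subseteq> chart_range (c m)) \<and>
      chart_range (c m) \<subseteq> (\<Union>k. interior (C k))" for m
  proof -
    obtain C :: "nat \<Rightarrow> (real ^ 'n) set" where C: "\<And>k. compact (C k)" "\<And>k. C k \<subseteq> chart_range (c m)"
      "\<And>k. C k \<subseteq> interior (C (Suc k))" "\<Union>(range C) = chart_range (c m)"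
      using open_Union_compact_subsets[OF open_chart_range[OF c[of m]]] by metis
    have "chart_range (c m) \<subseteq> (\<Union>k. interior (C k))"
    proof
      fix x assume "x \<in> chart_range (c m)"
      then obtain k where "x \<in> C k" using C(4) by blast
      with C(3) show "x \<in> (\<Union>k. interior (C k))" by blast
    qed
    with C show ?thesis by blast
  qed
  then obtain C :: "nat \<Rightarrow> nat \<Rightarrow> (real ^ 'n) set"
    where C: "\<And>m k. compact (C m k)" "\<And>m k. C m k \<subseteq> chart_range (c m)"
      "\<And>m. chart_range (c m) \<subseteq> (\<Union>k. interior (C m k))"
    by metis
  define L where "L i = (case prod_decode i of (m, k) \<Rightarrow> chart_inv (c m) ` C m k)" for i
  have L: "L (prod_encode (m, k)) = chart_inv (c m) ` C m k" for m k by (simp add: L_def)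
  have compact: "compactin X (chart_inv (c m) ` C m k)" for m k
  proof (rule image_compactin[OF _ continuous_chart_inv[OF c]])
    show "compactin (top_of_set (chart_range (c m))) (C m k)"
      using C(1,2) by (simp add: compactin_subtopology)
  qed
  have finite: "emeasure (riemannian_volume X \<A> g) (chart_inv (c m) ` C m k) < \<infinity>" for m k
  proof -
    have "chart_inv (c m) ` C m k \<subseteq> chart_dom (c m)"
      using C(2) chart_inv_in_dom by blast
    moreover have "chart_inv (c m) ` C m k \<in> sets (borel_algebra X)"
      using smooth_manifold compact
      by (intro closedin_in_borel_algebra compactin_imp_closedin) (simp_all add: smooth_manifold_def)
    ultimately show ?thesis
      using riemannian_volume_le_chart_volume[OF c] chart_volume_compact_finite[OF c C(1,2)]
      by (meson le_less_trans)
  qed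
  have "\<exists>I. finite I \<and> K \<subseteq> (\<Union>k\<in>I. L k)" if K: "compactin X K" for K
  proof -
    \<comment> \<open>the open cover by the images of the interiors, indexed like \<open>L\<close>\<close>
    define W where "W i = (case prod_decode i of (m, k) \<Rightarrow> chart_inv (c m) ` interior (C m k))" for i
    have "openin X U" if "U \<in> range W" for U
    proof -
      from that obtain m k where "U = chart_inv (c m) ` interior (C m k)"
        by (auto simp: W_def split: prod.splits)
      moreover have "interior (C m k) \<subseteq> chart_range (c m)"
        using C(2) interior_subset by blast
      ultimately show ?thesis using openin_chart_inv_image[OF c open_interior] by simp
    qed
    moreover have "K \<subseteq> \<Union>(range W)"
    proof
      fix p assume "p \<in> K"
      then have "p \<in> topspace X" using compactin_subset_topspace[OF K] by blast
      then obtain m where m: "p \<in> chart_dom (c m)" using cover by (auto simp: chart_cover_def)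
      then obtain k where "chart_map (c m) p \<in> interior (C m k)" using C(3)[of m] by blast
      then have "chart_inv (c m) (chart_map (c m) p) \<in> W (prod_encode (m, k))"
        by (auto simp: W_def)
      then show "p \<in> \<Union>(range W)" using m c by auto
    qed
    ultimately obtain \<F> where \<F>: "finite \<F>" "\<F> \<subseteq> range W" "K \<subseteq> \<Union>\<F>"
      using compactinD[OF K] by metis
    then obtain I where I: "finite I" "\<F> = W ` I" by (meson finite_subset_image)
    have W_L: "W i \<subseteq> L i" for i
    proof (cases "prod_decode i")
      case (Pair m k)
      then show ?thesis
        using image_mono[OF interior_subset, of "chart_inv (c m)" "C m k"] by (simp add: W_def L_def)
    qed
    have "K \<subseteq> (\<Union>i\<in>I. L i)"
    proof
      fix p assume "p \<in> K"
      then obtain i where "i \<in> I" "p \<in> W i" using \<F>(3) unfolding I(2) by blast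
      then show "p \<in> (\<Union>i\<in>I. L i)" using W_L by blast
    qed
    with I(1) show ?thesis by blast
  qed
  moreover have "compactin X (L i)" "emeasure (riemannian_volume X \<A> g) (L i) < \<infinity>" for i
    using compact finite by (simp_all add: L_def split: prod.splits)
  ultimately show ?thesis by blast
qed

end

text \<open>Borel--Cantelli for a sequence whose measures decay geometrically.\<close>

lemma null_sets_Inter_Union_geometric:
  assumes A: "\<And>n. A n \<in> sets M" and fin: "emeasure M (A 0) < \<infinity>"
    and step: "\<And>n. emeasure M (A (Suc n)) \<le> ennreal a * emeasure M (A n)"
    and a: "0 \<le> a" "a < 1"
  shows "(\<Inter>m. \<Union>n\<in>{m..}. A n) \<in> null_sets M"
proof -
  have le: "emeasure M (A n) \<le> ennreal (a ^ n) * emeasure M (A 0)" for n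
  proof (induction n)
    case (Suc n)
    have "emeasure M (A (Suc n)) \<le> ennreal a * (ennreal (a ^ n) * emeasure M (A 0))"
      using step[of n] Suc by (meson mult_left_mono order_trans zero_le)
    then show ?case using a by (simp add: ennreal_mult mult.assoc)
  qed simp
  have fin_n: "emeasure M (A n) < \<infinity>" for n
    using le[of n] fin by (simp add: ennreal_mult_less_top le_less_trans)
  have "summable (\<lambda>n. measure M (A n))"
  proof (rule summable_comparison_test')
    show "summable (\<lambda>n. a ^ n * measure M (A 0))"
      using a by (intro summable_mult2 summable_geometric) simp
    show "norm (measure M (A n)) \<le> a ^ n * measure M (A 0)" if "n \<ge> 0" for n
      using enn2real_mono[OF le[of n]] fin a
      by (simp add: measure_def enn2real_mult ennreal_mult_less_top)
  qed
  then have "limsup A \<in> null_sets M"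
    using A fin_n by (intro borel_cantelli_limsup1)
  then show ?thesis by (simp add: limsup_INF_SUP)
qed

text \<open>Put \<open>S n = {x. f\<^sup>-\<^sup>n(x) \<in> L}\<close>, which is \<open>f\<^sup>n(L)\<close>. Its volume shrinks by the factor \<open>a\<close> in each step,
  and the points in infinitely many \<open>S n\<close> are a null set.\<close>

lemma (in riemannian_manifold) backward_recurrent_null:
  assumes f: "diffeomorphism X \<A> f"
    and pullback: "\<And>p \<xi>. p \<in> topspace X \<Longrightarrow> (\<And>i. \<xi> i \<in> tangent_space \<A> p) \<Longrightarrow>
      pullback_form \<A> f \<omega> p \<xi> = A p * \<omega> p \<xi>"
    and a: "0 < a" "a < 1" and A: "\<And>p. p \<in> topspace X \<Longrightarrow> \<bar>A p\<bar> \<le> a"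
    and L: "compactin X L" "emeasure (riemannian_volume X \<A> g) L < \<infinity>"
  shows "{x \<in> topspace X. \<forall>N. \<exists>n\<ge>N. (inv_into (topspace X) f ^^ n) x \<in> L}
    \<in> null_sets (riemannian_volume X \<A> g)"
proof -
  let ?h = "inv_into (topspace X) f"
  have bij: "bij_betw f (topspace X) (topspace X)" and smooth: "smooth_map X \<A> f"
    and cont: "continuous_map X X ?h"
    using f by (simp_all add: diffeomorphism_def smooth_map_def)
  have inj: "inj_on f (topspace X)" using bij by (rule bij_betw_imp_inj_on)
  have image: "f ` E = {x \<in> topspace X. ?h x \<in> E}" if "E \<subseteq> topspace X" for E
  proof safe
    fix p assume p: "p \<in> E"
    then show "f p \<in> topspace X" using that bij by (auto simp: bij_betw_def)
    show "?h (f p) \<in> E" using p that inj by (simp add: inv_into_f_f subset_iff)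
  next
    fix x assume "x \<in> topspace X" "?h x \<in> E"
    then show "x \<in> f ` E" using bij by (metis bij_betw_inv_into_right imageI)
  qed
  have borel: "f ` E \<in> sets (borel_algebra X)" if "E \<in> sets (borel_algebra X)" for E
    using borel_algebra_preimage[OF cont that] by (simp only: image[OF in_borel_algebra_subset[OF that]])
  define S where "S n = {x \<in> topspace X. (?h ^^ n) x \<in> L}" for n
  have h_sub: "?h x \<in> topspace X" if "x \<in> topspace X" for x
    using that cont by (auto dest: continuous_map_funspace)
  have S_0: "S 0 = L"
    using compactin_subset_topspace[OF L(1)] by (auto simp: S_def)
  have S_Suc: "S (Suc n) = f ` S n" for n
  proof -
    have "f ` S n = {x \<in> topspace X. ?h x \<in> S n}" by (rule image) (auto simp: S_def)
    also have "\<dots> = S (Suc n)"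
      using h_sub by (auto simp: S_def funpow_swap1)
    finally show ?thesis by simp
  qed
  have S: "S n \<in> sets (borel_algebra X)" for n
  proof (induction n)
    case 0
    show ?case
      unfolding S_0 using smooth_manifold L(1)
      by (intro closedin_in_borel_algebra compactin_imp_closedin) (simp_all add: smooth_manifold_def)
  next
    case (Suc n)
    then show ?case unfolding S_Suc by (rule borel)
  qed
  have "(\<Inter>m. \<Union>n\<in>{m..}. S n) \<in> null_sets (riemannian_volume X \<A> g)"
  proof (rule null_sets_Inter_Union_geometric)
    show "emeasure (riemannian_volume X \<A> g) (S (Suc n))
        \<le> ennreal a * emeasure (riemannian_volume X \<A> g) (S n)" for n
      unfolding S_Suc using a(1)
      by (intro riemannian_volume_image_le[OF smooth inj borel pullback A _ S]) auto
  qed (use S L a in \<open>simp_all only: sets_riemannian_volume S_0 less_imp_le\<close>)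
  moreover have "(\<Inter>m. \<Union>n\<in>{m..}. S n) = {x \<in> topspace X. \<forall>N. \<exists>n\<ge>N. (?h ^^ n) x \<in> L}"
    by (auto simp: S_def)
  ultimately show ?thesis by simp
qed

theorem proposition1:
  fixes X :: "'a topology"
    and \<A> :: "('a, real ^ 'n) chart set"
    and g :: "('a, real ^ 'n) metric"
    and \<omega> :: "('a, 'n) top_form"
    and f :: "'a \<Rightarrow> 'a"
    and A :: "'a \<Rightarrow> real"
    and a :: real
  assumes "smooth_manifold X \<A>"
    and "riemannian_metric X \<A> g"
    and "riemannian_volume_form X \<A> g \<omega>"
    and "diffeomorphism X \<A> f"
    and "\<And>p \<xi>. p \<in> topspace X \<Longrightarrow> (\<And>i. \<xi> i \<in> tangent_space \<A> p) \<Longrightarrow>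
           pullback_form \<A> f \<omega> p \<xi> = A p * \<omega> p \<xi>"
    and "0 < a" and "a < 1"
    and "\<And>p. p \<in> topspace X \<Longrightarrow> \<bar>A p\<bar> \<le> a"
  shows "backward_nonescaping X f \<in> null_sets (riemannian_volume X \<A> g)"
proof (cases "topspace X = {}")
  case True
  then show ?thesis by (simp add: backward_nonescaping_def)
next
  case False
  interpret riemannian_manifold X \<A> g \<omega>
    using assms(1-3) by unfold_locales
  obtain L :: "nat \<Rightarrow> 'a set" where L: "\<And>k. compactin X (L k)"
    "\<And>k. emeasure (riemannian_volume X \<A> g) (L k) < \<infinity>"
    and cover: "\<And>K. compactin X K \<Longrightarrow> \<exists>I. finite I \<and> K \<subseteq> (\<Union>k\<in>I. L k)"
    using compact_finite_volume_cover[OF False] by blast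
  let ?h = "inv_into (topspace X) f"
  let ?R = "\<lambda>K. {x \<in> topspace X. \<forall>N. \<exists>n\<ge>N. (?h ^^ n) x \<in> K}"
  have "backward_nonescaping X f = (\<Union>K\<in>{K. compactin X K}. ?R K)"
    by (auto simp: backward_nonescaping_def tends_to_infinity_def)
  also have "\<dots> = (\<Union>k. ?R (L k))"
  proof
    show "(\<Union>K\<in>{K. compactin X K}. ?R K) \<subseteq> (\<Union>k. ?R (L k))"
    proof
      fix x assume "x \<in> (\<Union>K\<in>{K. compactin X K}. ?R K)"
      then obtain K where K: "compactin X K" "x \<in> topspace X" "\<forall>N. \<exists>n\<ge>N. (?h ^^ n) x \<in> K" by blast
      obtain I where I: "finite I" "K \<subseteq> (\<Union>k\<in>I. L k)" using cover[OF K(1)] by blast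
      \<comment> \<open>pigeonhole: finitely many \<open>L k\<close> share infinitely many visits to \<open>K\<close>\<close>
      have "infinite {n. (?h ^^ n) x \<in> K}"
        using K(3) by (simp add: infinite_nat_iff_unbounded_le)
      moreover have "{n. (?h ^^ n) x \<in> K} \<subseteq> (\<Union>k\<in>I. {n. (?h ^^ n) x \<in> L k})"
        using I(2) by blast
      ultimately obtain k where "infinite {n. (?h ^^ n) x \<in> L k}"
        using I(1) by (meson finite_UN_I finite_subset)
      then have "x \<in> ?R (L k)"
        using K(2) by (simp add: infinite_nat_iff_unbounded_le)
      then show "x \<in> (\<Union>k. ?R (L k))" by blast
    qed
    show "(\<Union>k. ?R (L k)) \<subseteq> (\<Union>K\<in>{K. compactin X K}. ?R K)"
      using L(1) by blast
  qed
  also have "\<dots> \<in> null_sets (riemannian_volume X \<A> g)"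
    using backward_recurrent_null[OF assms(4,5,6,7,8) L]
    by (intro null_sets_UN) simp_all
  finally show ?thesis .
qed

end
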